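(* Let $\mathbf{k}$ be a nonarchimedean local field of characteristic different from $2$ (of arbitrary residual characteristic), let $W$ be a $2n$-dimensional symplectic vector space over $\mathbf{k}$ ($n\ge 1$), and let $0\le i\le n$. Consider the Weil representation $\omega=\omega_\psi$ of the metaplectic group $\widetilde{\operatorname{Sp}}(W)$ in its Schrödinger model on $S(Y)$, where $\psi$ has conductor $2e$, $e$ being the valuation of $2$ in $\mathbf{k}$. Let $\widetilde{K}_i\subset\widetilde{\operatorname{Sp}}(W)$ be the full inverse image of the stabilizer $K_i$ of the lattice $\mathcal{L}_i$. Then $\widetilde{K}_i$ preserves the filtration $$S_{i,0}\subset S'_{i,1}\subset S_{i,1}\subset S'_{i,2}\subset S_{i,2}\subset\cdots$$ (i.e. each of the subspaces $S_{i,m}$ for $m\ge 0$ and $S'_{i,m}$ for $m\ge 1$ of $S(Y)$ is stable under $\omega(\widetilde{K}_i)$), and $\widetilde{K}_i$ acts irreducibly on the components $S_{i,0}^{+}$ and $S_{i,0}^{-}$ of $S_{i,0}=S_{i,0}^+\oplus S_{i,0}^-$. (For $i=0$ one has $S_{0,0}^-=0$, and the irreducibility assertion concerns only $S_{0,0}^+=S_{0,0}$.)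
   Context: Field and character: $\mathfrak{o}$ is the ring of integers of $\mathbf{k}$, $\varpi$ a uniformizer, $q=|\mathfrak{o}/\varpi\mathfrak{o}|$, and $e$ is the valuation of $2$ in $\mathbf{k}$ (so $e=0$ if $q$ is odd). $\psi$ is a fixed nontrivial smooth additive character of $\mathbf{k}$ of conductor $2e$: $\psi(tx)=1$ for all $t\in\mathfrak{o}$ if and only if $x\in 4\mathfrak{o}$. Symplectic space: $W$ has a symplectic basis $\{e_1,\dots,e_n,f_1,\dots,f_n\}$ in which the form is $Q(u,v)={}^{\intercal}u\begin{bmatrix}0&1\\-1&0\end{bmatrix}v$. Let $X$ be the span of the $e_j$ and $Y\cong\mathbf{k}^n$ the span of the $f_j$. $\operatorname{Sp}(W)$ is the group of linear automorphisms of $W$ preserving $Q$. Lattices and compact groups: $\mathcal{L}_i$ is the $\mathfrak{o}$-span of $\{e_1,\dots,e_n,\varpi f_1,\dots,\varpi f_i,f_{i+1},\dots,f_n\}$, and $\mathcal{L}_i^\ast$ is the dual lattice, the $\mathfrak{o}$-span of $\{\varpi^{-1}e_1,\dots,\varpi^{-1}e_i,e_{i+1},\dots,e_n,f_1,\dots,f_n\}$. $K_i$ is the subgroup of $\operatorname{Sp}(W)$ stabilizing $\mathcal{L}_i$ (equivalently $\mathcal{L}_i^\ast$). Set $L_i=\mathcal{L}_i\cap Y=\varpi\mathfrak{o}^i\oplus\mathfrak{o}^{n-i}$ and $L'_i=\mathcal{L}_i^\ast\cap Y=\mathfrak{o}^n$. Function spaces: $S(Y)$ is the space of Schwartz functions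 (locally constant, compactly supported, complex-valued) on $Y$. For an integer $m$, $S_{i,m}$ is the subspace of functions supported on $\varpi^{-m}L'_i$ and invariant under translation by $2\varpi^mL_i$; $S'_{i,m}$ is the subspace of functions supported on $\varpi^{-m}L_i$ and invariant under translation by $2\varpi^mL'_i$. For a subspace $U\subset S(Y)$, $U^+$ and $U^-$ denote the even and odd functions in $U$. Weil representation: $\widetilde{\operatorname{Sp}}(W)$ is the metaplectic group, the two-fold central extension of $\operatorname{Sp}(W)$ to which the projective Weil representation attached to $\psi$ lifts as a linear representation $\omega$. (The projective representation comes from the irreducible representation with central character $\psi$ of the Heisenberg group $W\times\mathbf{k}$ with product $(u,s)(v,t)=(u+v,s+t+Q(u,v))$.) In the Schrödinger model on $S(Y)$, $\omega$ is given by $$[\tilde{x}(a)\phi](y)=\psi({}^{\intercal}y\,a\,y)\phi(y),\qquad[\tilde{h}(a)\phi](y)=\beta_a|\det a|^{1/2}\phi({}^{\intercal}a\,y),\qquad[\tilde{w}\phi](y)=\gamma_1\widehat{\phi}(y),$$ where $\tilde{x}(a)$ is the lift of $\begin{bmatrix}1&a\\0&1\end{bmatrix}$ for symmetric $a\in M_n(\mathbf{k})$ (the lift being a homomorphism in $a$), $\tilde{h}(a)$ is a lift of $\begin{bmatrix}a&0\\0&{}^{\intercal}a^{-1}\end{bmatrix}$ for $a\in\operatorname{GL}_n(\mathbf{k})$, $\tilde{w}$ is a lift of $\begin{bmatrix}0&1\\-1&0\end{bmatrix}$, $\beta_a$ and $\gamma_1$ are complex roots of unity (depending on the lifts), and $\widehat{\phi}(u)=\int_Y\psi(2\,{}^{\intercal}v\,u)\phi(v)\,dv$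 with the self-dual Haar measure, i.e. $\widehat{\widehat{\phi}}(-v)=\phi(v)$. *)

theory Defs
  imports "HOL-Analysis.Analysis" "HOL-Algebra.Coset"
begin

section \<open>Nonarchimedean local fields\<close>

text \<open>The value of a valuation at 0 is never used; 0 is treated separately.\<close>

definition integer_ring :: "('k::field \<Rightarrow> int) \<Rightarrow> 'k set" where
  "integer_ring v = {x. x = 0 \<or> 0 \<le> v x}"

definition maximal_ideal :: "('k::field \<Rightarrow> int) \<Rightarrow> 'k set" where
  "maximal_ideal v = {x. x = 0 \<or> 1 \<le> v x}"

definition residue_field :: "('k::field \<Rightarrow> int) \<Rightarrow> 'k set set" where
  "residue_field v = integer_ring v //
     {(x, y). x \<in> integer_ring v \<and> y \<in> integer_ring v \<and> y - x \<in> maximal_ideal v}"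

definition absval :: "('k::field \<Rightarrow> int) \<Rightarrow> 'k \<Rightarrow> real" where
  "absval v x = (if x = 0 then 0 else real (card (residue_field v)) powi (- v x))"

text \<open>Completeness is the class \<^class>\<open>complete_space\<close>: the metric of the type is
  required to be the one given by the normalised absolute value, so that the library notions of
  open, compact and Borel set on \<open>'k\<close> and on \<open>'k ^ 'n\<close> are the usual ones.\<close>

locale nonarch_local_field =
  fixes v :: "'k::{field,complete_space} \<Rightarrow> int"
  assumes val_mult: "\<And>x y. x \<noteq> 0 \<Longrightarrow> y \<noteq> 0 \<Longrightarrow> v (x * y) = v x + v y"
    and val_add: "\<And>x y. x \<noteq> 0 \<Longrightarrow> y \<noteq> 0 \<Longrightarrow> x + y \<noteq> 0 \<Longrightarrow> min (v x) (v y) \<le> v (x + y)"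
    and val_normalised: "\<exists>x. x \<noteq> 0 \<and> v x = 1"
    and finite_residue_field: "finite (residue_field v)"
    and dist_absval: "\<And>x y. dist x y = absval v (x - y)"

definition locally_constant :: "('a::topological_space \<Rightarrow> 'b) \<Rightarrow> bool" where
  "locally_constant f \<longleftrightarrow> (\<forall>x. \<exists>U. open U \<and> x \<in> U \<and> (\<forall>y\<in>U. f y = f x))"

definition smooth_additive_character :: "('k::{field,topological_space} \<Rightarrow> complex) \<Rightarrow> bool" where
  "smooth_additive_character \<psi> \<longleftrightarrow>
     (\<forall>x y. \<psi> (x + y) = \<psi> x * \<psi> y) \<and> (\<forall>x. \<psi> x \<noteq> 0) \<and> locally_constant \<psi>"

text \<open>Conductor \<open>2e\<close>, where \<open>e = v 2\<close>.\<close>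

definition has_conductor_2e :: "('k::field \<Rightarrow> int) \<Rightarrow> ('k \<Rightarrow> complex) \<Rightarrow> bool" where
  "has_conductor_2e v \<psi> \<longleftrightarrow>
     (\<forall>x. (\<forall>t\<in>integer_ring v. \<psi> (t * x) = 1) \<longleftrightarrow> x \<in> (\<lambda>t. 4 * t) ` integer_ring v)"

section \<open>The symplectic space\<close>

text \<open>\<open>W\<close> is \<open>'k ^ ('n + 'n)\<close>: the coordinate \<open>Inl j\<close> belongs to \<open>e\<^sub>j\<close> and \<open>Inr j\<close> to \<open>f\<^sub>j\<close>.
  Both \<open>X\<close> and \<open>Y\<close> are identified with \<open>'k ^ 'n\<close>. Elements of \<open>Sp(W)\<close> are matrices with
  respect to this basis, acting on column vectors.\<close>

definition e_basis :: "'n::finite \<Rightarrow> 'k::field ^ ('n + 'n)" where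
  "e_basis j = axis (Inl j) 1"

definition f_basis :: "'n::finite \<Rightarrow> 'k::field ^ ('n + 'n)" where
  "f_basis j = axis (Inr j) 1"

definition X_part :: "'k ^ ('n::finite + 'n) \<Rightarrow> 'k ^ 'n" where
  "X_part u = (\<chi> j. u $ Inl j)"

definition Y_part :: "'k ^ ('n::finite + 'n) \<Rightarrow> 'k ^ 'n" where
  "Y_part u = (\<chi> j. u $ Inr j)"

definition Y_embed :: "'k::field ^ 'n \<Rightarrow> 'k ^ ('n::finite + 'n)" where
  "Y_embed y = (\<Sum>j\<in>UNIV. y $ j *s f_basis j)"

definition block_matrix ::
    "'k ^ 'n ^ 'n \<Rightarrow> 'k ^ 'n ^ 'n \<Rightarrow> 'k ^ 'n ^ 'n \<Rightarrow> 'k ^ 'n ^ 'n \<Rightarrow> 'k ^ ('n::finite + 'n) ^ ('n + 'n)" where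
  "block_matrix a b c d = (\<chi> r s. case r of
       Inl j \<Rightarrow> (case s of Inl l \<Rightarrow> a $ j $ l | Inr l \<Rightarrow> b $ j $ l)
     | Inr j \<Rightarrow> (case s of Inl l \<Rightarrow> c $ j $ l | Inr l \<Rightarrow> d $ j $ l))"

definition symp_form :: "'k::field ^ ('n::finite + 'n) \<Rightarrow> 'k ^ ('n + 'n) \<Rightarrow> 'k" where
  "symp_form u w = scalar_product u (block_matrix 0 (mat 1) (- mat 1) 0 *v w)"

definition Sp :: "('k::field ^ ('n::finite + 'n) ^ ('n + 'n)) monoid" where
  "Sp = \<lparr>carrier = {g. invertible g \<and> (\<forall>u w. symp_form (g *v u) (g *v w) = symp_form u w)},
         mult = (**), one = mat 1\<rparr>"

section \<open>Lattices\<close>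

definition finite_span :: "'k::field set \<Rightarrow> ('k ^ 'm) set \<Rightarrow> ('k ^ 'm) set" where
  "finite_span R B = {\<Sum>b\<in>B. c b *s b | c. \<forall>b\<in>B. c b \<in> R}"

text \<open>\<open>card {..<j} < i\<close> says that \<open>j\<close> is one of the first \<open>i\<close> indices.\<close>

definition lattice_W ::
    "('k::field \<Rightarrow> int) \<Rightarrow> 'k \<Rightarrow> nat \<Rightarrow> ('k ^ ('n::{finite,linorder} + 'n)) set" where
  "lattice_W v \<pi> i = finite_span (integer_ring v)
     (range e_basis \<union> (\<lambda>j. if card {..<j} < i then \<pi> *s f_basis j else f_basis j) ` UNIV)"

definition dual_lattice :: "('k::field \<Rightarrow> int) \<Rightarrow> ('k ^ ('n::finite + 'n)) set \<Rightarrow> ('k ^ ('n + 'n)) set" where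
  "dual_lattice v \<L> = {w. \<forall>u\<in>\<L>. symp_form u w \<in> integer_ring v}"

definition stabilizer_K ::
    "('k::field \<Rightarrow> int) \<Rightarrow> 'k \<Rightarrow> nat \<Rightarrow> ('k ^ ('n::{finite,linorder} + 'n) ^ ('n + 'n)) set" where
  "stabilizer_K v \<pi> i = {g \<in> carrier Sp. (\<lambda>u. g *v u) ` lattice_W v \<pi> i = lattice_W v \<pi> i}"

definition lattice_Y ::
    "('k::field \<Rightarrow> int) \<Rightarrow> 'k \<Rightarrow> nat \<Rightarrow> ('k ^ 'n::{finite,linorder}) set" where
  "lattice_Y v \<pi> i = {y. Y_embed y \<in> lattice_W v \<pi> i}"

definition lattice_Y' ::
    "('k::field \<Rightarrow> int) \<Rightarrow> 'k \<Rightarrow> nat \<Rightarrow> ('k ^ 'n::{finite,linorder}) set" where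
  "lattice_Y' v \<pi> i = {y. Y_embed y \<in> dual_lattice v (lattice_W v \<pi> i)}"

section \<open>Function spaces\<close>

definition schwartz :: "('a::topological_space \<Rightarrow> complex) set" where
  "schwartz = {\<phi>. locally_constant \<phi> \<and> compact (closure {y. \<phi> y \<noteq> 0})}"

definition supported_invariant ::
    "('a::{topological_space,plus}) set \<Rightarrow> 'a set \<Rightarrow> ('a \<Rightarrow> complex) set" where
  "supported_invariant A B =
     {\<phi> \<in> schwartz. {y. \<phi> y \<noteq> 0} \<subseteq> A \<and> (\<forall>y. \<forall>t\<in>B. \<phi> (y + t) = \<phi> y)}"

definition S_space :: "('k::{field,metric_space} \<Rightarrow> int) \<Rightarrow> 'k \<Rightarrow> nat \<Rightarrow> int
    \<Rightarrow> ('k ^ 'n::{finite,linorder} \<Rightarrow> complex) set" where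
  "S_space v \<pi> i m = supported_invariant
     ((\<lambda>y. (\<pi> powi (- m)) *s y) ` lattice_Y' v \<pi> i)
     ((\<lambda>y. (2 * \<pi> powi m) *s y) ` lattice_Y v \<pi> i)"

definition S'_space :: "('k::{field,metric_space} \<Rightarrow> int) \<Rightarrow> 'k \<Rightarrow> nat \<Rightarrow> int
    \<Rightarrow> ('k ^ 'n::{finite,linorder} \<Rightarrow> complex) set" where
  "S'_space v \<pi> i m = supported_invariant
     ((\<lambda>y. (\<pi> powi (- m)) *s y) ` lattice_Y v \<pi> i)
     ((\<lambda>y. (2 * \<pi> powi m) *s y) ` lattice_Y' v \<pi> i)"

definition even_part :: "('a::uminus \<Rightarrow> complex) set \<Rightarrow> ('a \<Rightarrow> complex) set" where
  "even_part U = {\<phi> \<in> U. \<forall>y. \<phi> (- y) = \<phi> y}"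

definition odd_part :: "('a::uminus \<Rightarrow> complex) set \<Rightarrow> ('a \<Rightarrow> complex) set" where
  "odd_part U = {\<phi> \<in> U. \<forall>y. \<phi> (- y) = - \<phi> y}"

section \<open>Representations on spaces of functions\<close>

definition fun_subspace :: "('a \<Rightarrow> complex) set \<Rightarrow> bool" where
  "fun_subspace U \<longleftrightarrow> (\<lambda>y. 0) \<in> U \<and> (\<forall>\<phi>\<in>U. \<forall>\<eta>\<in>U. (\<lambda>y. \<phi> y + \<eta> y) \<in> U)
     \<and> (\<forall>c. \<forall>\<phi>\<in>U. (\<lambda>y. c * \<phi> y) \<in> U)"

definition representation_on :: "('g, 'b) monoid_scheme
    \<Rightarrow> ('g \<Rightarrow> ('a \<Rightarrow> complex) \<Rightarrow> 'a \<Rightarrow> complex) \<Rightarrow> ('a \<Rightarrow> complex) set \<Rightarrow> bool" where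
  "representation_on G \<omega> U \<longleftrightarrow>
     (\<forall>g\<in>carrier G. \<forall>\<phi>\<in>U. \<omega> g \<phi> \<in> U) \<and>
     (\<forall>g\<in>carrier G. \<forall>\<phi>\<in>U. \<forall>\<eta>\<in>U. \<omega> g (\<lambda>y. \<phi> y + \<eta> y) = (\<lambda>y. \<omega> g \<phi> y + \<omega> g \<eta> y)) \<and>
     (\<forall>g\<in>carrier G. \<forall>c. \<forall>\<phi>\<in>U. \<omega> g (\<lambda>y. c * \<phi> y) = (\<lambda>y. c * \<omega> g \<phi> y)) \<and>
     (\<forall>\<phi>\<in>U. \<omega> \<one>\<^bsub>G\<^esub> \<phi> = \<phi>) \<and>
     (\<forall>g\<in>carrier G. \<forall>h\<in>carrier G. \<forall>\<phi>\<in>U. \<omega> (g \<otimes>\<^bsub>G\<^esub> h) \<phi> = \<omega> g (\<omega> h \<phi>))"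

definition stable_under :: "'g set \<Rightarrow> ('g \<Rightarrow> ('a \<Rightarrow> complex) \<Rightarrow> 'a \<Rightarrow> complex)
    \<Rightarrow> ('a \<Rightarrow> complex) set \<Rightarrow> bool" where
  "stable_under K \<omega> U \<longleftrightarrow> (\<forall>g\<in>K. \<forall>\<phi>\<in>U. \<omega> g \<phi> \<in> U)"

definition acts_irreducibly :: "'g set \<Rightarrow> ('g \<Rightarrow> ('a \<Rightarrow> complex) \<Rightarrow> 'a \<Rightarrow> complex)
    \<Rightarrow> ('a \<Rightarrow> complex) set \<Rightarrow> bool" where
  "acts_irreducibly K \<omega> U \<longleftrightarrow> fun_subspace U \<and> stable_under K \<omega> U \<and> U \<noteq> {\<lambda>y. 0} \<and>
     (\<forall>V. fun_subspace V \<and> V \<subseteq> U \<and> stable_under K \<omega> V \<longrightarrow> V = {\<lambda>y. 0} \<or> V = U)"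

section \<open>The Weil representation\<close>

definition two_fold_central_extension ::
    "('g, 'b) monoid_scheme \<Rightarrow> ('h, 'c) monoid_scheme \<Rightarrow> ('g \<Rightarrow> 'h) \<Rightarrow> bool" where
  "two_fold_central_extension G H p \<longleftrightarrow>
     group G \<and> p \<in> hom G H \<and> p ` carrier G = carrier H \<and> card (kernel G H p) = 2 \<and>
     (\<forall>z\<in>kernel G H p. \<forall>g\<in>carrier G. z \<otimes>\<^bsub>G\<^esub> g = g \<otimes>\<^bsub>G\<^esub> z)"

definition fourier :: "('k::{field,metric_space} \<Rightarrow> complex) \<Rightarrow> ('k ^ 'n) measure
    \<Rightarrow> ('k ^ 'n \<Rightarrow> complex) \<Rightarrow> 'k ^ 'n \<Rightarrow> complex" where
  "fourier \<psi> \<mu> \<phi> u = (LINT w|\<mu>. \<psi> (2 * scalar_product w u) * \<phi> w)"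

definition self_dual_haar ::
    "('k::{field,metric_space} \<Rightarrow> complex) \<Rightarrow> ('k ^ 'n) measure \<Rightarrow> bool" where
  "self_dual_haar \<psi> \<mu> \<longleftrightarrow> sets \<mu> = sets borel \<and>
     (\<forall>A\<in>sets borel. \<forall>t. emeasure \<mu> ((\<lambda>y. t + y) ` A) = emeasure \<mu> A) \<and>
     (\<forall>C. compact C \<longrightarrow> emeasure \<mu> C < \<infinity>) \<and>
     (\<forall>\<phi>\<in>schwartz. \<forall>y. fourier \<psi> \<mu> (fourier \<psi> \<mu> \<phi>) (- y) = \<phi> y)"

definition heisenberg :: "(('k::field ^ ('n::finite + 'n)) \<times> 'k) monoid" where
  "heisenberg = \<lparr>carrier = UNIV,
     mult = (\<lambda>(u, s) (w, t). (u + w, s + t + symp_form u w)), one = (0, 0)\<rparr>"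

text \<open>The Schroedinger realisation on functions on \<open>Y\<close> of the representation of the
  Heisenberg group with central character \<open>\<psi>\<close>: \<open>X\<close> acts by multiplication by characters and
  \<open>Y\<close> by translations. Replacing \<open>u\<close> by \<open>-u\<close> would give the other common convention; it leads to the
  same intertwining operators because \<open>-1\<close> is central in \<open>Sp(W)\<close>.\<close>

definition schroedinger :: "('k::field \<Rightarrow> complex) \<Rightarrow> ('k ^ ('n::finite + 'n)) \<times> 'k
    \<Rightarrow> ('k ^ 'n \<Rightarrow> complex) \<Rightarrow> 'k ^ 'n \<Rightarrow> complex" where
  "schroedinger \<psi> = (\<lambda>(u, s) \<phi> y.
     \<psi> (s - scalar_product (X_part u) (Y_part u) + 2 * scalar_product (X_part u) y) * \<phi> (y - Y_part u))"

lemma sum_UNIV_Plus: "(\<Sum>r\<in>(UNIV::('n::finite+'n) set). f r) = (\<Sum>j\<in>UNIV. f (Inl j)) + (\<Sum>j\<in>UNIV. f (Inr j))"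
  by (subst UNIV_Plus_UNIV[symmetric], subst sum.Plus) (auto simp del: UNIV_Plus_UNIV)

lemma block_matrix_vector: "X_part (block_matrix a b c d *v u) = a *v X_part u + b *v Y_part u"
  "Y_part (block_matrix a b c d *v u) = c *v X_part u + d *v Y_part u"
  for a :: "'k::field ^'n^'n"
  by (auto simp: X_part_def Y_part_def block_matrix_def matrix_vector_mult_def vec_eq_iff sum_UNIV_Plus)

lemma scalar_product_parts: "scalar_product u w = scalar_product (X_part u) (X_part w) + scalar_product (Y_part u) (Y_part w)"
  by (simp add: scalar_product_def sum_UNIV_Plus X_part_def Y_part_def)

lemma scalar_product_linear: "scalar_product (x + x') y = scalar_product x y + scalar_product x' y"
  "scalar_product y (x + x') = scalar_product y x + scalar_product y x'"
  "scalar_product (x - x') y = scalar_product x y - scalar_product x' y"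
  "scalar_product y (x - x') = scalar_product y x - scalar_product y x'"
  "scalar_product (- x) y = - scalar_product x y"
  "scalar_product y (- x) = - scalar_product y x" for y :: "'k::field^'n"
  by (auto simp: scalar_product_def algebra_simps sum.distrib sum_subtractf sum_negf)

lemma uminus_mat_vector: "(- mat 1) *v x = - (x :: 'k::field^'n)"
  by (simp add: matrix_vector_mult_def mat_def vec_eq_iff if_distrib[of uminus] if_distrib[of "\<lambda>x. x * _"] sum.delta  cong: if_cong)

lemma symp_form_eq:
  "symp_form u w = scalar_product (X_part u) (Y_part w) - scalar_product (Y_part u) (X_part w)"
  unfolding symp_form_def scalar_product_parts[of u] block_matrix_vector by (simp add: scalar_product_linear uminus_mat_vector)

lemma X_part_Y_part_add: "X_part (u + w) = X_part u + X_part w" "Y_part (u + w) = Y_part u + Y_part w"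
  for u :: "'k::field ^ ('n::finite + 'n)"
  by (auto simp: X_part_def Y_part_def vec_eq_iff)

lemma scalar_product_commute: "scalar_product x y = scalar_product y (x::'k::field^'n)"
  by (simp add: scalar_product_def mult.commute)

lemma schroedinger_mult:
  fixes \<psi> :: "'k::field \<Rightarrow> complex"
  assumes "\<And>x y. \<psi> (x + y) = \<psi> x * \<psi> y"
  shows "schroedinger \<psi> (g \<otimes>\<^bsub>heisenberg\<^esub> h) \<phi> = schroedinger \<psi> g (schroedinger \<psi> h \<phi>)"
proof -
  obtain u s w t where gh: "g = (u, s)" "h = (w, t)" by fastforce
  let ?sp = "scalar_product"
  have "\<psi> (s + t + symp_form u w - ?sp (X_part (u + w)) (Y_part (u + w)) + 2 * ?sp (X_part (u + w)) y)
      = \<psi> (s - ?sp (X_part u) (Y_part u) + 2 * ?sp (X_part u) y)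
        * \<psi> (t - ?sp (X_part w) (Y_part w) + 2 * ?sp (X_part w) (y - Y_part u))" for y
    unfolding assms[symmetric] symp_form_eq X_part_Y_part_add scalar_product_linear
    by (rule arg_cong[of _ _ \<psi>]) (simp add: algebra_simps scalar_product_commute[of "Y_part u"])
  then show ?thesis
    by (auto simp: gh heisenberg_def schroedinger_def fun_eq_iff X_part_Y_part_add diff_diff_eq)
qed

definition root_of_unity :: "complex \<Rightarrow> bool" where
  "root_of_unity z \<longleftrightarrow> (\<exists>N>0. z ^ N = 1)"

text \<open>The metaplectic group \<open>Mp\<close> with projection \<open>p\<close> and its representation \<open>\<omega>\<close>. The assumption
  \<open>lifts_projective\<close> says that \<open>\<omega>\<close> lifts the projective representation of \<open>Sp(W)\<close> obtained from
  the Heisenberg group.\<close>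

locale weil_representation =
  fixes v :: "'k::{field,metric_space} \<Rightarrow> int"
    and \<psi> :: "'k \<Rightarrow> complex"
    and \<mu> :: "('k ^ 'n) measure"
    and Mp :: "('g, 'b) monoid_scheme"
    and p :: "'g \<Rightarrow> 'k ^ ('n::finite + 'n) ^ ('n + 'n)"
    and \<omega> :: "'g \<Rightarrow> ('k ^ 'n \<Rightarrow> complex) \<Rightarrow> 'k ^ 'n \<Rightarrow> complex"
  assumes extension: "two_fold_central_extension Mp Sp p"
    and representation: "representation_on Mp \<omega> schwartz"
    and lifts_projective: "\<And>g u s \<phi>. g \<in> carrier Mp \<Longrightarrow> \<phi> \<in> schwartz \<Longrightarrow>
          \<omega> g (schroedinger \<psi> (u, s) \<phi>) = schroedinger \<psi> (p g *v u, s) (\<omega> g \<phi>)"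
    and formula_x: "\<exists>x. (\<forall>a. transpose a = a \<longrightarrow> x a \<in> carrier Mp \<and>
            p (x a) = block_matrix (mat 1) a 0 (mat 1) \<and>
            (\<forall>\<phi>\<in>schwartz. \<omega> (x a) \<phi> = (\<lambda>y. \<psi> (scalar_product y (a *v y)) * \<phi> y))) \<and>
          (\<forall>a b. transpose a = a \<and> transpose b = b \<longrightarrow> x (a + b) = x a \<otimes>\<^bsub>Mp\<^esub> x b)"
    and formula_h: "\<And>a. invertible a \<Longrightarrow> \<exists>h\<in>carrier Mp. \<exists>\<beta>. root_of_unity \<beta> \<and>
            p h = block_matrix a 0 0 (matrix_inv (transpose a)) \<and>
            (\<forall>\<phi>\<in>schwartz. \<omega> h \<phi> =
               (\<lambda>y. \<beta> * complex_of_real (sqrt (absval v (det a))) * \<phi> (transpose a *v y)))"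
    and formula_w: "\<exists>w\<in>carrier Mp. \<exists>\<gamma>. root_of_unity \<gamma> \<and>
            p w = block_matrix 0 (mat 1) (- mat 1) 0 \<and>
            (\<forall>\<phi>\<in>schwartz. \<omega> w \<phi> = (\<lambda>u. \<gamma> * fourier \<psi> \<mu> \<phi> u))"

text \<open>The full inverse image of \<open>K\<^sub>i\<close> in the metaplectic group.\<close>

definition stabilizer_K_cover :: "('k::field \<Rightarrow> int) \<Rightarrow> 'k \<Rightarrow> ('g, 'b) monoid_scheme
    \<Rightarrow> ('g \<Rightarrow> 'k ^ ('n::{finite,linorder} + 'n) ^ ('n + 'n)) \<Rightarrow> nat \<Rightarrow> 'g set" where
  "stabilizer_K_cover v \<pi> Mp p i = {g \<in> carrier Mp. p g \<in> stabilizer_K v \<pi> i}"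

end

theory Submission
  imports Defs
begin

text \<open>The functions in \<open>S\<^sub>i\<^sub>,\<^sub>m\<close> (in \<open>S'\<^sub>i\<^sub>,\<^sub>m\<close>) are the Schwartz functions fixed by the Heisenberg operators of all
  vectors in \<open>2 \<pi>\<^sup>m L\<close> (in \<open>2 \<pi>\<^sup>m L\<^sup>*\<close>), where \<open>L\<close> is the lattice stabilised by \<open>K\<close>; so the stability of these
  spaces follows from that of \<open>L\<close> and its dual. On \<open>S\<^sub>i\<^sub>,\<^sub>0\<close> the reflection \<open>y \<mapsto> -y\<close> is a multiple of a sum of Heisenberg
  operators over \<open>2 L\<^sup>* / 2 L\<close>, so it commutes with the group and the even and odd parts are stable.

  For the irreducibility, the characters \<open>\<psi>(y\<^sup>T a y)\<close> of the unipotent elements of \<open>K\<close> separate the classes of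
  integral vectors modulo \<open>2 L \<inter> Y\<close> up to sign. Hence a nonzero invariant subspace contains some \<open>\<delta>\<^sub>y = 1\<^sub>y \<plusminus> 1\<^sub>-\<^sub>y\<close>.
  The Fourier transform, rescaled to lie in \<open>K\<close>, maps \<open>\<delta>\<^sub>y\<close> to a nonzero multiple of \<open>z \<mapsto> \<psi>(s) \<plusminus> \<psi>(-s)\<close> with
  \<open>s = 2 \<Sum> y\<^sub>j z\<^sub>j / c\<^sub>j\<close> (\<open>c\<^sub>j\<close> is \<open>\<pi>\<close> for the first \<open>i\<close> indices and \<open>1\<close> for the others), and where this is nonzero
  \<open>\<delta>\<^sub>z\<close> is in the subspace as well. In the even case all \<open>\<delta>\<^sub>z\<close> are reached through \<open>y = 0\<close>; in the odd case two
  given vectors have a common partner because two proper subgroups do not cover a group.\<close>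

section \<open>Valuation arithmetic and the ring of integers\<close>

context nonarch_local_field
begin

lemma val_one [simp]: "v 1 = 0"
  using val_mult[of 1 1] by simp

lemma val_minus_one: "v (-1) = 0"
  using val_mult[of "-1" "-1"] by simp

lemma val_uminus [simp]: "v (- x) = v x"
  using val_mult[of "-1" x] by (cases "x = 0") (auto simp: val_minus_one)

lemma val_inverse: "x \<noteq> 0 \<Longrightarrow> v (inverse x) = - v x"
  using val_mult[of x "inverse x"] by simp

lemma val_divide: "x \<noteq> 0 \<Longrightarrow> y \<noteq> 0 \<Longrightarrow> v (x / y) = v x - v y"
  by (simp add: divide_inverse val_mult val_inverse)

lemma val_power: "x \<noteq> 0 \<Longrightarrow> v (x ^ k) = int k * v x"
  by (induction k) (auto simp: val_mult algebra_simps)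

lemma val_power_int: "x \<noteq> 0 \<Longrightarrow> v (x powi m) = m * v x"
  by (cases m rule: int_cases) (auto simp: power_int_def val_power val_inverse algebra_simps)

abbreviation ring_of_integers ("\<O>") where "\<O> \<equiv> integer_ring v"

lemma integer_ring_0 [simp]: "0 \<in> \<O>" and integer_ring_1 [simp]: "1 \<in> \<O>"
  by (auto simp: integer_ring_def)

lemma integer_ring_add [intro]: "x \<in> \<O> \<Longrightarrow> y \<in> \<O> \<Longrightarrow> x + y \<in> \<O>"
  using val_add[of x y] by (cases "x = 0"; cases "y = 0"; cases "x + y = 0") (auto simp: integer_ring_def)

lemma integer_ring_uminus [simp]: "- x \<in> \<O> \<longleftrightarrow> x \<in> \<O>"
  by (auto simp: integer_ring_def)

lemma integer_ring_diff [intro]: "x \<in> \<O> \<Longrightarrow> y \<in> \<O> \<Longrightarrow> x - y \<in> \<O>"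
  using integer_ring_add[of x "- y"] by simp

lemma integer_ring_mult [intro]: "x \<in> \<O> \<Longrightarrow> y \<in> \<O> \<Longrightarrow> x * y \<in> \<O>"
  by (cases "x = 0"; cases "y = 0") (auto simp: integer_ring_def val_mult)

lemma integer_ring_sum [intro]: "(\<And>j. j \<in> J \<Longrightarrow> f j \<in> \<O>) \<Longrightarrow> sum f J \<in> \<O>"
  by (induction J rule: infinite_finite_induct) auto

lemma integer_ring_of_nat [simp]: "of_nat k \<in> \<O>"
  by (induction k) auto

lemma integer_ring_numeral [simp]: "numeral k \<in> \<O>"
  using integer_ring_of_nat[of "numeral k"] by simp

lemma integer_ring_power [intro]: "x \<in> \<O> \<Longrightarrow> x ^ k \<in> \<O>"
  by (induction k) auto

text \<open>If \<open>a\<close> were not integral, neither would be \<open>b\<close>, since they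
  differ by an integer; then both valuations are negative, and so is that of the product.\<close>

lemma integer_ring_conjugate_factor:
  assumes "a * b \<in> \<O>" "a - b \<in> \<O>"
  shows "a \<in> \<O>"
proof (rule ccontr)
  assume a: "a \<notin> \<O>"
  then have a0: "a \<noteq> 0" and va: "v a < 0"
    by (auto simp: integer_ring_def)
  have "b \<notin> \<O>"
    using a assms(2) integer_ring_add[of "a - b" b] by auto
  then have "b \<noteq> 0" "v b < 0"
    by (auto simp: integer_ring_def)
  then show False
    using assms(1) a0 va by (auto simp: integer_ring_def val_mult)
qed

end

section \<open>Divisibility by the uniformizer, finite quotients of the ring of integers, and the
  metric\<close>

locale uniformized_field = nonarch_local_field v
  for v :: "'k::{field,complete_space} \<Rightarrow> int" +
  fixes \<pi> :: 'k
  assumes two_nonzero: "(2::'k) \<noteq> 0"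
    and uniformizer_nonzero [simp]: "\<pi> \<noteq> 0"
    and val_uniformizer: "v \<pi> = 1"
begin

lemma four_nonzero: "(4::'k) \<noteq> 0"
proof -
  have "(4::'k) = 2 * 2" by simp
  then show ?thesis using two_nonzero by (metis mult_eq_0_iff)
qed

lemma uniformizer_integral [simp]: "\<pi> \<in> \<O>"
  by (simp add: integer_ring_def val_uniformizer)

lemma val_uniformizer_power_int: "v (\<pi> powi m) = m"
  by (simp add: val_power_int val_uniformizer)

text \<open>\<open>\<pi>\<close> generates a prime ideal: two nonnegative integers with sum at least
  1 cannot both be 0.\<close>

lemma integer_ring_prime:
  assumes "a \<in> \<O>" "b \<in> \<O>" "a * b / \<pi> \<in> \<O>"
  shows "a / \<pi> \<in> \<O> \<or> b / \<pi> \<in> \<O>"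
  using assms
  by (cases "a = 0"; cases "b = 0") (auto simp: integer_ring_def val_mult val_divide val_uniformizer)

text \<open>The two factors of \<open>(x\<^sup>2 - y\<^sup>2) / 4\<close> differ by an integer, so they are both integral as soon as their
  product is.\<close>
lemma half_diff_integral:
  assumes "y \<in> \<O>" "(x\<^sup>2 - y\<^sup>2) / 4 \<in> \<O>"
  shows "(x - y) / 2 \<in> \<O>" "(x + y) / 2 \<in> \<O>"
proof -
  let ?a = "(x - y) / 2" and ?b = "(x + y) / 2"
  have *: "?a * ?b = (x\<^sup>2 - y\<^sup>2) / 4"
    by (simp add: power2_eq_square algebra_simps)
  have "?b - ?a = y"
    using two_nonzero four_nonzero by (simp add: field_simps)
  moreover from this have "?a - ?b = - y"
    by (metis minus_diff_eq)
  ultimately show "?a \<in> \<O>" "?b \<in> \<O>"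
    using assms * integer_ring_conjugate_factor[of ?a ?b] integer_ring_conjugate_factor[of ?b ?a]
    by (metis integer_ring_uminus, metis mult.commute)
qed

text \<open>Both half factors are integral, but primality of \<open>\<pi>\<close> lets only one of
  them be known to absorb it. This is where the sign ambiguity between \<open>y\<close> and
  \<open>- y\<close> enters.\<close>

lemma half_diff_divisible:
  assumes "y \<in> \<O>" "(x\<^sup>2 - y\<^sup>2) / (4 * \<pi>) \<in> \<O>"
  shows "(x - y) / (2 * \<pi>) \<in> \<O> \<or> (x + y) / (2 * \<pi>) \<in> \<O>"
proof -
  let ?a = "(x - y) / 2" and ?b = "(x + y) / 2"
  have int: "(x\<^sup>2 - y\<^sup>2) / 4 \<in> \<O>"
    using integer_ring_mult[OF assms(2) uniformizer_integral] four_nonzero by simp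
  have "?a * ?b / \<pi> = (x\<^sup>2 - y\<^sup>2) / (4 * \<pi>)"
    by (simp add: power2_eq_square algebra_simps)
  then have "?a / \<pi> \<in> \<O> \<or> ?b / \<pi> \<in> \<O>"
    using integer_ring_prime[OF half_diff_integral[OF assms(1) int]] assms(2) by (simp only: simp_thms)
  then show ?thesis by simp
qed

text \<open>The classes of 0 and 1 differ, so the base of the powers in \<open>absval\<close>
  exceeds 1 and \<open>absval\<close> is strictly decreasing in the valuation.\<close>

lemma residue_card: "card (residue_field v) \<ge> 2"
proof -
  let ?r = "{(x, y). x \<in> \<O> \<and> y \<in> \<O> \<and> y - x \<in> maximal_ideal v}"
  have "?r `` {0} \<noteq> ?r `` {1}"
  proof
    assume "?r `` {0} = ?r `` {1}"
    moreover have "1 \<in> ?r `` {1}" "1 \<notin> ?r `` {0}"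
      by (auto simp: maximal_ideal_def)
    ultimately show False by blast
  qed
  then have "card {?r `` {0}, ?r `` {1}} = 2" by simp
  moreover have "{?r `` {0}, ?r `` {1}} \<subseteq> residue_field v"
    unfolding residue_field_def by (simp only: insert_subset empty_subsetI simp_thms)
      (intro conjI quotientI integer_ring_0 integer_ring_1)
  ultimately show ?thesis
    using card_mono[OF finite_residue_field, of "{?r `` {0}, ?r `` {1}}"] by simp
qed

text \<open>The bridge between the metric and integrality, through which all topological facts below
  pass.\<close>

lemma absval_le_iff: "y \<noteq> 0 \<Longrightarrow> absval v x \<le> absval v y \<longleftrightarrow> x / y \<in> \<O>"
  using residue_card power_int_strict_increasing[of "- v y" "- v x" "real (card (residue_field v))"]
    power_int_increasing[of "- v x" "- v y" "real (card (residue_field v))"]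
  by (cases "v y \<le> v x") (auto simp: absval_def integer_ring_def val_divide)

lemma residue_representatives: "\<exists>F. finite F \<and> F \<subseteq> \<O> \<and> (\<forall>x\<in>\<O>. \<exists>f\<in>F. (x - f) / \<pi> \<in> \<O>)"
proof -
  let ?r = "{(x, y). x \<in> \<O> \<and> y \<in> \<O> \<and> y - x \<in> maximal_ideal v}"
  let ?F = "(\<lambda>C. SOME x. x \<in> C) ` residue_field v"
  have max: "x / \<pi> \<in> \<O>" if "x \<in> maximal_ideal v" for x
    using that
    by (cases "x = 0") (auto simp: maximal_ideal_def integer_ring_def val_divide val_uniformizer)
  have *: "(SOME y. y \<in> ?r `` {x}) \<in> ?r `` {x}" if "x \<in> \<O>" for x
    by (rule someI[of _ x]) (use that in \<open>auto simp: maximal_ideal_def\<close>)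
  have "finite ?F" using finite_residue_field by simp
  moreover have "?F \<subseteq> \<O>"
  proof
    fix f assume "f \<in> ?F"
    then obtain x where "x \<in> \<O>" "f = (SOME y. y \<in> ?r `` {x})"
      unfolding residue_field_def quotient_def by blast
    then show "f \<in> \<O>" using *[of x] by blast
  qed
  moreover have "\<exists>f\<in>?F. (x - f) / \<pi> \<in> \<O>" if "x \<in> \<O>" for x
  proof (intro bexI)
    let ?f = "SOME y. y \<in> ?r `` {x}"
    show "?f \<in> ?F"
      unfolding residue_field_def using quotientI[OF that, of ?r] by blast
    have "(?f - x) / \<pi> \<in> \<O>" using *[OF that] max by blast
    then show "(x - ?f) / \<pi> \<in> \<O>"
      using integer_ring_uminus[of "(?f - x) / \<pi>"] by (simp add: minus_divide_left del: integer_ring_uminus)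
  qed
  ultimately show ?thesis by (intro exI[of _ ?F] conjI ballI)
qed

text \<open>Finitely many truncated \<open>\<pi>\<close>-adic expansions suffice; each induction
  step appends one more digit.\<close>

lemma power_representatives: "\<exists>F. finite F \<and> F \<subseteq> \<O> \<and> (\<forall>x\<in>\<O>. \<exists>f\<in>F. (x - f) / \<pi> ^ k \<in> \<O>)"
proof (induction k)
  case 0
  then show ?case by (intro exI[of _ "{0}"]) auto
next
  case (Suc k)
  then obtain F where F: "finite F" "F \<subseteq> \<O>" "\<forall>x\<in>\<O>. \<exists>f\<in>F. (x - f) / \<pi> ^ k \<in> \<O>" by blast
  obtain G where G: "finite G" "G \<subseteq> \<O>" "\<forall>x\<in>\<O>. \<exists>f\<in>G. (x - f) / \<pi> \<in> \<O>"
    using residue_representatives by blast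
  let ?H = "(\<lambda>(f, g). f + \<pi> ^ k * g) ` (F \<times> G)"
  have "\<exists>h\<in>?H. (x - h) / \<pi> ^ Suc k \<in> \<O>" if x: "x \<in> \<O>" for x
  proof -
    obtain f where f: "f \<in> F" "(x - f) / \<pi> ^ k \<in> \<O>" using F(3) x by blast
    obtain g where g: "g \<in> G" "((x - f) / \<pi> ^ k - g) / \<pi> \<in> \<O>" using G(3) f(2) by blast
    have "((x - f) / \<pi> ^ k - g) / \<pi> = (x - (f + \<pi> ^ k * g)) / \<pi> ^ Suc k"
      by (simp add: field_simps)
    moreover have "f + \<pi> ^ k * g \<in> ?H"
      using f(1) g(1) by force
    ultimately show ?thesis using g(2) by (intro bexI[of _ "f + \<pi> ^ k * g"]) simp_all
  qed
  moreover have "?H \<subseteq> \<O>" using F(2) G(2)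
    by (auto simp: subset_iff intro!: integer_ring_add integer_ring_mult integer_ring_power)
  moreover have "finite ?H" using F(1) G(1) by simp
  ultimately show ?case by (intro exI[of _ ?H] conjI ballI)
qed

lemma integer_ring_representatives:
  assumes "a \<noteq> 0"
  shows "\<exists>F. finite F \<and> F \<subseteq> \<O> \<and> (\<forall>x\<in>\<O>. \<exists>f\<in>F. (x - f) / a \<in> \<O>)"
proof -
  \<comment> \<open>For negative \<open>v a\<close> the exponent is cut off at 0; then
    \<open>1 / a\<close> is integral already, so the divisibility below holds in both cases.\<close>
  let ?k = "nat (v a)"
  obtain F where F: "finite F" "F \<subseteq> \<O>" "\<forall>x\<in>\<O>. \<exists>f\<in>F. (x - f) / \<pi> ^ ?k \<in> \<O>"
    using power_representatives[of ?k] by blast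
  have *: "\<pi> ^ ?k / a \<in> \<O>"
    using assms by (simp add: integer_ring_def val_divide val_power val_uniformizer)
  have "(x - f) / a \<in> \<O>" if "(x - f) / \<pi> ^ ?k \<in> \<O>" for x f
    using integer_ring_mult[OF that *] by simp
  then have "\<forall>x\<in>\<O>. \<exists>f\<in>F. (x - f) / a \<in> \<O>"
    using F(3) by meson
  then show ?thesis using F(1,2) by blast
qed

lemma open_coset: "a \<noteq> 0 \<Longrightarrow> open {x. (x - y) / a \<in> \<O>}"
proof -
  assume a: "a \<noteq> 0"
  have "\<exists>e>0. \<forall>z. dist z x < e \<longrightarrow> z \<in> {x. (x - y) / a \<in> \<O>}" if x: "(x - y) / a \<in> \<O>" for x
  proof (intro exI conjI allI impI)
    \<comment> \<open>By the ultrametric inequality the whole ball of radius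
      \<open>absval v a\<close> around a point stays in its coset of \<open>a\<close> times
      \<open>\<O>\<close>.\<close>
    show "absval v a > 0" using a residue_card by (simp add: absval_def)
    fix z assume "dist z x < absval v a"
    then have "(z - x) / a \<in> \<O>" using absval_le_iff[OF a, of "z - x"] by (simp add: dist_absval)
    from integer_ring_add[OF this x] show "z \<in> {x. (x - y) / a \<in> \<O>}"
      by (simp add: add_divide_distrib[symmetric])
  qed
  then show ?thesis unfolding open_dist by blast
qed

end

section \<open>Representatives of finite quotients and sums over them\<close>

definition transversal :: "'a::ab_group_add set \<Rightarrow> 'a set \<Rightarrow> 'a set \<Rightarrow> bool" where
  "transversal A B R \<longleftrightarrow> finite R \<and> R \<subseteq> A \<and> (\<forall>y\<in>A. \<exists>!r. r \<in> R \<and> y - r \<in> B)"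

definition additive_subgroup :: "'a::ab_group_add set \<Rightarrow> bool" where
  "additive_subgroup B \<longleftrightarrow> 0 \<in> B \<and> (\<forall>x\<in>B. \<forall>y\<in>B. x - y \<in> B)"

lemma additive_subgroupD:
  assumes "additive_subgroup B"
  shows "0 \<in> B" "x \<in> B \<Longrightarrow> y \<in> B \<Longrightarrow> x - y \<in> B" "x \<in> B \<Longrightarrow> - x \<in> B" "x \<in> B \<Longrightarrow> y \<in> B \<Longrightarrow> x + y \<in> B"
proof -
  show 0: "0 \<in> B" and d: "x \<in> B \<Longrightarrow> y \<in> B \<Longrightarrow> x - y \<in> B" for x y
    using assms by (auto simp: additive_subgroup_def)
  show m: "- x \<in> B" if "x \<in> B" for x using d[OF 0 that] by simp
  show "x \<in> B \<Longrightarrow> y \<in> B \<Longrightarrow> x + y \<in> B" using d[OF _ m, of x y] by simp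
qed

text \<open>A choice from the finite covering set \<open>F\<close> that depends only on the coset of
  \<open>y\<close> keeps exactly one representative per coset.\<close>

lemma exists_transversal:
  assumes B: "additive_subgroup B"
    and F: "finite F" "F \<subseteq> A" "\<forall>y\<in>A. \<exists>f\<in>F. y - f \<in> B"
  shows "\<exists>R. transversal A B R"
proof -
  define rep where "rep y = (SOME f. f \<in> F \<and> y - f \<in> B)" for y
  have rep: "rep y \<in> F \<and> y - rep y \<in> B" if "y \<in> A" for y
  proof -
    from F(3) that obtain f where "f \<in> F \<and> y - f \<in> B" by blast
    then show ?thesis unfolding rep_def by (rule someI)
  qed
  \<comment> \<open>Congruent elements give the same predicate on \<open>f\<close>, hence the same
    choice by \<open>SOME\<close>.\<close>
  have rep_eq: "rep x = rep y" if "x - y \<in> B" for x y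
  proof -
    have "x - f \<in> B \<longleftrightarrow> y - f \<in> B" for f
      using additive_subgroupD(2)[OF B, of "x - f" "x - y"] additive_subgroupD(4)[OF B, of "y - f" "x - y"] that
      by auto
    then show ?thesis unfolding rep_def by simp
  qed
  have "transversal A B (rep ` A)"
    unfolding transversal_def
  proof (intro conjI ballI)
    show "finite (rep ` A)"
      by (rule finite_subset[OF _ F(1)]) (use rep in blast)
    show "rep ` A \<subseteq> A" using rep F(2) by blast
    fix y assume y: "y \<in> A"
    show "\<exists>!r. r \<in> rep ` A \<and> y - r \<in> B"
    proof (intro ex1I conjI)
      show "rep y \<in> rep ` A" "y - rep y \<in> B" using y rep by auto
      fix r assume r: "r \<in> rep ` A \<and> y - r \<in> B"
      then obtain x where x: "x \<in> A" "r = rep x" by blast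
      have "(y - r) - (x - r) \<in> B"
        using additive_subgroupD(2)[OF B, of "y - r" "x - r"] r x rep[of x] by metis
      then show "r = rep y" using rep_eq[of y x] x by simp
    qed
  qed
  then show ?thesis by blast
qed

text \<open>\<open>T\<close> is injective modulo \<open>B\<close>, so it permutes the finitely many
  cosets, and \<open>F\<close> is a function of the coset. It serves for translations in character
  sums and for the action of the group on \<open>L_dual\<close> modulo \<open>L\<close>.\<close>

lemma sum_transversal_reindex:
  fixes F :: "'a::ab_group_add \<Rightarrow> 'b::comm_monoid_add"
  assumes B: "additive_subgroup B" and R: "transversal A B R"
    and T: "\<And>x. x \<in> A \<Longrightarrow> T x \<in> A" "\<And>x y. x \<in> A \<Longrightarrow> y \<in> A \<Longrightarrow> T x - T y \<in> B \<Longrightarrow> x - y \<in> B"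
    and F: "\<And>x y. x \<in> A \<Longrightarrow> y \<in> A \<Longrightarrow> x - y \<in> B \<Longrightarrow> F x = F y"
  shows "(\<Sum>r\<in>R. F (T r)) = (\<Sum>r\<in>R. F r)"
proof -
  \<comment> \<open>The permutation of \<open>R\<close> induced by \<open>T\<close>; being an
    injective self-map of a finite set, it is onto.\<close>
  define f where "f r = (THE r'. r' \<in> R \<and> T r - r' \<in> B)" for r
  have uniq: "\<exists>!r. r \<in> R \<and> y - r \<in> B" if "y \<in> A" for y
    using R that by (auto simp: transversal_def)
  have RA: "r \<in> A" if "r \<in> R" for r using R that by (auto simp: transversal_def)
  have f: "f r \<in> R \<and> T r - f r \<in> B" if "r \<in> R" for r
    unfolding f_def by (rule theI'[OF uniq]) (use that RA T in blast)
  have inj: "inj_on f R"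
  proof
    fix r s assume rs: "r \<in> R" "s \<in> R" "f r = f s"
    have "(T r - f r) - (T s - f s) \<in> B"
      using additive_subgroupD(2)[OF B] f[OF rs(1)] f[OF rs(2)] by metis
    then have "r - s \<in> B" using T(2) RA rs by simp
    moreover have "r - r \<in> B" using additive_subgroupD(1)[OF B] by simp
    ultimately show "r = s" using uniq[OF RA[OF rs(1)]] rs by blast
  qed
  have finR: "finite R" using R by (simp add: transversal_def)
  have surj: "f ` R = R"
    by (rule endo_inj_surj[OF finR _ inj]) (use f in blast)
  have "(\<Sum>r\<in>R. F (T r)) = (\<Sum>r\<in>R. F (f r))"
    using f RA T(1) by (intro sum.cong refl F) simp_all
  also have "\<dots> = (\<Sum>r\<in>f ` R. F r)"
    using inj by (simp add: sum.reindex)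
  finally show ?thesis using surj by simp
qed

text \<open>Translation by \<open>a\<close> leaves the sum unchanged but multiplies it by
  \<open>\<kappa> a\<close>, which is not 1.\<close>

lemma sum_character_transversal:
  fixes \<kappa> :: "'a::ab_group_add \<Rightarrow> complex"
  assumes A: "additive_subgroup A" and B: "additive_subgroup B" "B \<subseteq> A" and R: "transversal A B R"
    and \<kappa>: "\<And>x y. \<kappa> (x + y) = \<kappa> x * \<kappa> y" "\<And>x. x \<in> B \<Longrightarrow> \<kappa> x = 1"
    and a: "a \<in> A" "\<kappa> a \<noteq> 1"
  shows "(\<Sum>r\<in>R. \<kappa> r) = 0"
proof -
  have "(\<Sum>r\<in>R. \<kappa> (a + r)) = (\<Sum>r\<in>R. \<kappa> r)"
  proof (rule sum_transversal_reindex[OF B(1) R])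
    fix x y assume "x - y \<in> B"
    then show "\<kappa> x = \<kappa> y"
      using \<kappa>(1)[of "x - y" y] \<kappa>(2) by simp
  qed (use a additive_subgroupD(4)[OF A] in auto)
  then have "(\<kappa> a - 1) * (\<Sum>r\<in>R. \<kappa> r) = 0"
    by (simp add: \<kappa>(1) sum_distrib_left algebra_simps)
  then show ?thesis using a by simp
qed

section \<open>Coordinates on the symplectic space\<close>

lemma scalar_product_axis: "scalar_product (axis j t) y = t * y $ j"
  for y :: "'k::field ^ 'n::finite"
proof -
  have "scalar_product (axis j t) y = (\<Sum>l\<in>UNIV. if l = j then t * y $ j else 0)"
    unfolding scalar_product_def axis_def by (intro sum.cong) auto
  then show ?thesis by simp
qed

lemma scalar_product_scale: "scalar_product (t *s x) y = t * scalar_product x y"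
  "scalar_product x (t *s y) = t * scalar_product x y" for y :: "'k::field ^ 'n::finite"
  by (auto simp: scalar_product_def sum_distrib_left algebra_simps)

lemma scalar_product_0 [simp]: "scalar_product 0 y = 0" "scalar_product y 0 = 0"
  for y :: "'k::field ^ 'n::finite"
  by (auto simp: scalar_product_def)

lemma parts_basis [simp]:
  "X_part (e_basis j) = axis j 1" "Y_part (e_basis j) = 0"
  "X_part (f_basis j) = 0" "Y_part (f_basis j) = axis j 1"
  by (auto simp: X_part_def Y_part_def e_basis_def f_basis_def axis_def vec_eq_iff)

lemma parts_scale [simp]: "X_part (t *s u) = t *s X_part u" "Y_part (t *s u) = t *s Y_part u"
  by (auto simp: X_part_def Y_part_def vec_eq_iff)

lemma parts_0 [simp]: "X_part 0 = 0" "Y_part 0 = 0"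
  by (auto simp: X_part_def Y_part_def vec_eq_iff)

lemma parts_uminus [simp]: "X_part (- u) = - X_part u" "Y_part (- u) = - Y_part u"
  by (auto simp: X_part_def Y_part_def vec_eq_iff)

lemma parts_diff: "X_part (u - w) = X_part u - X_part w" "Y_part (u - w) = Y_part u - Y_part w"
  for u :: "'k::field ^ ('n::finite + 'n)"
  by (auto simp: X_part_def Y_part_def vec_eq_iff)

lemma parts_sum: "X_part (sum f J) = (\<Sum>j\<in>J. X_part (f j))" "Y_part (sum f J) = (\<Sum>j\<in>J. Y_part (f j))"
  by (auto simp: X_part_def Y_part_def vec_eq_iff)

lemma parts_eqI: "X_part u = X_part w \<Longrightarrow> Y_part u = Y_part w \<Longrightarrow> u = w"
  unfolding X_part_def Y_part_def vec_eq_iff by (metis sum.exhaust vec_lambda_beta)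

lemma sum_axis: "(\<Sum>j\<in>UNIV. (y $ j) *s axis j 1) = (y :: 'k::field ^ 'n::finite)"
  by (simp add: vec_eq_iff axis_def if_distrib[of "\<lambda>t. _ * t"] cong: if_cong)

lemma parts_Y_embed [simp]: "X_part (Y_embed y) = 0" "Y_part (Y_embed y) = y"
  for y :: "'k::field ^ 'n::finite"
  unfolding Y_embed_def parts_sum parts_scale parts_basis sum_axis by simp_all

section \<open>Diagonal lattices and their topology\<close>

context uniformized_field
begin

text \<open>For nonzero \<open>d j\<close> this is the product of the fractional ideals generated by
  the \<open>d j\<close>. Supports, periods and the two halves of \<open>L\<close> and of its dual
  all have this form, so comparing them reduces to quotients of scalars.\<close>

definition lat :: "('n::finite \<Rightarrow> 'k) \<Rightarrow> ('k ^ 'n) set" where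
  "lat d = {y. \<forall>j. y $ j / d j \<in> \<O>}"

lemma lat_subgroup: "additive_subgroup (lat d)"
  by (auto simp: additive_subgroup_def lat_def diff_divide_distrib)

lemmas lat_0 = additive_subgroupD(1)[OF lat_subgroup]
lemmas lat_diff = additive_subgroupD(2)[OF lat_subgroup]
lemmas lat_uminus = additive_subgroupD(3)[OF lat_subgroup]
lemmas lat_add = additive_subgroupD(4)[OF lat_subgroup]

lemma lat_uminus_iff [simp]: "- y \<in> lat d \<longleftrightarrow> y \<in> lat d"
  using lat_uminus[of y d] lat_uminus[of "- y" d] by auto

lemma lat_mono:
  assumes "\<And>j. d' j \<noteq> 0" "\<And>j. d j \<noteq> 0" "\<And>j. d j / d' j \<in> \<O>"
  shows "lat d \<subseteq> lat d'"
proof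
  fix y assume "y \<in> lat d"
  then have "y $ j / d j * (d j / d' j) \<in> \<O>" for j
    using assms(3)[of j] by (intro integer_ring_mult) (simp_all only: lat_def mem_Collect_eq)
  moreover have "y $ j / d j * (d j / d' j) = y $ j / d' j" for j
    using assms(2)[of j] by simp
  ultimately show "y \<in> lat d'" by (simp only: lat_def mem_Collect_eq simp_thms)
qed

lemma open_lat_coset: "(\<And>j. d j \<noteq> 0) \<Longrightarrow> open {y. y - x \<in> lat d}"
  using open_vector_box[of "\<lambda>j. {t. (t - x $ j) / d j \<in> \<O>}"] open_coset by (auto simp: lat_def)

text \<open>The coordinates are independent: representatives of \<open>\<O>\<close> modulo
  \<open>b j / a j\<close> are rescaled by \<open>a j\<close> and combined in all possible
  ways.\<close>

lemma lat_representatives: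
  assumes nz: "\<And>j. a j \<noteq> 0" "\<And>j. b j \<noteq> 0"
  shows "\<exists>F. finite F \<and> F \<subseteq> lat a \<and> (\<forall>y\<in>lat a. \<exists>f\<in>F. y - f \<in> lat b)"
proof -
  have "\<forall>j. \<exists>F. finite F \<and> F \<subseteq> \<O> \<and> (\<forall>x\<in>\<O>. \<exists>f\<in>F. (x - f) / (b j / a j) \<in> \<O>)"
    using nz by (intro allI integer_ring_representatives) auto
  then obtain F where F: "\<And>j. finite (F j)" "\<And>j. F j \<subseteq> \<O>" "\<And>j x. x \<in> \<O> \<Longrightarrow> \<exists>f\<in>F j. (x - f) / (b j / a j) \<in> \<O>"
    by metis
  let ?H = "(\<lambda>f. \<chi> j. a j * f j) ` (PiE UNIV F)"
  have "finite ?H" using F(1) by (intro finite_imageI finite_PiE) auto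
  moreover have "f j \<in> \<O>" if "f \<in> PiE UNIV F" for f j
    using that F(2)[of j] by (simp add: PiE_iff subset_iff)
  then have "?H \<subseteq> lat a" using nz(1) by (auto simp: lat_def)
  moreover have "\<exists>h\<in>?H. y - h \<in> lat b" if y: "y \<in> lat a" for y
  proof -
    have "\<forall>j. \<exists>f. f \<in> F j \<and> (y $ j / a j - f) / (b j / a j) \<in> \<O>"
      using F(3) y by (auto simp: lat_def Bex_def)
    then obtain f where f: "\<And>j. f j \<in> F j" "\<And>j. (y $ j / a j - f j) / (b j / a j) \<in> \<O>"
      by metis
    have "(y $ j / a j - f j) / (b j / a j) = (y $ j - a j * f j) / b j" for j
      using nz[of j] by (simp add: field_simps)
    then have "(y $ j - a j * f j) / b j \<in> \<O>" for j
      using f(2)[of j] by (simp only:)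
    then have "y - (\<chi> j. a j * f j) \<in> lat b" by (simp add: lat_def)
    moreover have "(\<chi> j. a j * f j) \<in> ?H" using f(1) by auto
    ultimately show ?thesis by blast
  qed
  ultimately show ?thesis by (intro exI[of _ ?H] conjI ballI)
qed

lemma lat_transversal:
  assumes "\<And>j. a j \<noteq> 0" "\<And>j. b j \<noteq> 0"
  shows "\<exists>R. transversal (lat a) (lat b) R"
proof -
  have "\<exists>F. finite F \<and> F \<subseteq> lat a \<and> (\<forall>y\<in>lat a. \<exists>f\<in>F. y - f \<in> lat b)"
    by (rule lat_representatives) (use assms in auto)
  then show ?thesis
    by (elim exE conjE) (rule exists_transversal[OF lat_subgroup])
qed

lemma lat_small:
  assumes "e > 0"
  shows "\<exists>b. (\<forall>j. b j \<noteq> 0) \<and> (\<forall>y::'k^'n::finite. \<forall>z. y - z \<in> lat b \<longrightarrow> dist z y < e)"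
proof -
  define q where "q = real (card (residue_field v))"
  have q: "q \<ge> 2" using residue_card by (simp add: q_def)
  \<comment> \<open>The distance is at most the sum of the coordinate distances, hence at most
    \<open>CARD('n) / q ^ k\<close>, which this choice of \<open>k\<close> makes smaller than
    \<open>e\<close>.\<close>
  obtain k where k: "real CARD('n) / e < q ^ k"
    using real_arch_pow[of q] q by force
  have "dist z y < e" if y: "y - z \<in> lat (\<lambda>_. \<pi> ^ k)" for y z :: "'k^'n"
  proof -
    have "dist (z $ j) (y $ j) \<le> absval v (\<pi> ^ k)" for j
      using absval_le_iff[of "\<pi> ^ k" "y $ j - z $ j"] y
      by (simp add: dist_commute[of "z $ j"] lat_def flip: dist_absval)
    then have "(\<Sum>j\<in>UNIV. dist (z $ j) (y $ j)) \<le> (\<Sum>j\<in>(UNIV::'n set). absval v (\<pi> ^ k))"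
      by (rule sum_mono)
    also have "\<dots> = real CARD('n) / q ^ k"
      using q by (simp add: absval_def val_power val_uniformizer q_def power_int_minus divide_inverse)
    also have "\<dots> < e" using k assms q by (simp add: field_simps)
    finally show ?thesis unfolding dist_vec_def
      using L2_set_le_sum[of UNIV "\<lambda>j. dist (z $ j) (y $ j)"] by simp
  qed
  then show ?thesis by (intro exI[of _ "\<lambda>_. \<pi> ^ k"]) auto
qed

text \<open>An open subgroup is closed, because its complement is a union of open cosets.\<close>

lemma closed_lat:
  assumes "\<And>j. d j \<noteq> 0"
  shows "closed (lat d)"
proof -
  have "- lat d = (\<Union>x\<in>- lat d. {y. y - x \<in> lat d})"
  proof (intro equalityI subsetI)
    fix y assume "y \<in> - lat d"
    then show "y \<in> (\<Union>x\<in>- lat d. {y. y - x \<in> lat d})" using lat_0[of d] by force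
  next
    fix y assume "y \<in> (\<Union>x\<in>- lat d. {y. y - x \<in> lat d})"
    then obtain x where "x \<notin> lat d" "y - x \<in> lat d" by blast
    then show "y \<in> - lat d" using lat_diff[of y d "y - x"] by auto
  qed
  moreover have "open (\<Union>x\<in>- lat d. {y. y - x \<in> lat d})"
    using open_lat_coset[of d] assms by blast
  ultimately show ?thesis by (simp add: closed_def)
qed

text \<open>Closedness in a complete space gives completeness; total boundedness holds because
  finitely many cosets of an arbitrarily small lattice cover \<open>lat d\<close>.\<close>

lemma compact_lat:
  assumes d: "\<And>j. d j \<noteq> 0"
  shows "compact (lat d)"
  unfolding compact_eq_totally_bounded
proof (intro conjI allI impI)
  show "complete (lat d)" using closed_lat[OF d] by (simp add: complete_eq_closed)
  fix e :: real assume "e > 0"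
  then obtain b where b: "\<forall>j. b j \<noteq> 0" "\<forall>y::'k^'a. \<forall>z. y - z \<in> lat b \<longrightarrow> dist z y < e"
    using lat_small by blast
  obtain F where F: "finite F" "\<forall>y\<in>lat d. \<exists>f\<in>F. y - f \<in> lat b"
    using lat_representatives[of d b] d b(1) by metis
  then have "lat d \<subseteq> (\<Union>x\<in>F. ball x e)"
    using b(2) unfolding subset_iff UN_iff mem_ball by meson
  then show "\<exists>k. finite k \<and> lat d \<subseteq> (\<Union>x\<in>k. ball x e)" using F(1) by blast
qed

text \<open>The Schwartz condition is automatic here: periodicity under an open lattice gives local
  constancy, and the support lies in a compact lattice.\<close>

lemma supported_invariant_lat:
  assumes a: "\<And>j. a j \<noteq> 0" and b: "\<And>j. b j \<noteq> 0"
  shows "supported_invariant (lat a) (lat b)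
    = {\<phi>. (\<forall>y. \<phi> y \<noteq> 0 \<longrightarrow> y \<in> lat a) \<and> (\<forall>y. \<forall>t\<in>lat b. \<phi> (y + t) = \<phi> y)}"
proof -
  have "\<phi> \<in> schwartz" if supp: "\<forall>y. \<phi> y \<noteq> 0 \<longrightarrow> y \<in> lat a" and inv: "\<forall>y. \<forall>t\<in>lat b. \<phi> (y + t) = \<phi> y" for \<phi>
  proof -
    have "locally_constant \<phi>"
      unfolding locally_constant_def
    proof
      fix x
      show "\<exists>U. open U \<and> x \<in> U \<and> (\<forall>y\<in>U. \<phi> y = \<phi> x)"
      proof (intro exI conjI ballI)
        show "open {y. y - x \<in> lat b}"
          using b by (intro open_lat_coset) auto
        show "x \<in> {y. y - x \<in> lat b}" by (simp add: lat_0)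
        fix y assume "y \<in> {y. y - x \<in> lat b}"
        then have "\<phi> (x + (y - x)) = \<phi> x" using inv by blast
        then show "\<phi> y = \<phi> x" by simp
      qed
    qed
    moreover have "closure {y. \<phi> y \<noteq> 0} \<subseteq> lat a"
      using supp closed_lat[of a] a by (intro closure_minimal) auto
    then have "compact (closure {y. \<phi> y \<noteq> 0})"
      using compact_Int_closed[OF compact_lat[of a] closed_closure[of "{y. \<phi> y \<noteq> 0}"]] a
      by (simp add: Int_absorb1)
    ultimately show ?thesis by (simp add: schwartz_def)
  qed
  then show ?thesis by (auto simp: supported_invariant_def)
qed

end

section \<open>The lattice, its dual and the function spaces in coordinates\<close>

definition join_parts :: "'k ^ 'n \<Rightarrow> 'k ^ 'n \<Rightarrow> 'k ^ ('n::finite + 'n)" where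
  "join_parts x y = (\<chi> r. case r of Inl j \<Rightarrow> x $ j | Inr j \<Rightarrow> y $ j)"

lemma parts_join_parts [simp]: "X_part (join_parts x y) = x" "Y_part (join_parts x y) = y"
  by (auto simp: join_parts_def X_part_def Y_part_def vec_eq_iff)

locale weil_setup = uniformized_field v \<pi> + weil_representation v \<psi> \<mu> Mp p \<omega>
  for v :: "'k::{field,complete_space} \<Rightarrow> int"
    and \<pi> :: 'k
    and \<psi> :: "'k \<Rightarrow> complex"
    and \<mu> :: "('k ^ 'n::{finite,linorder}) measure"
    and Mp :: "('g, 'b) monoid_scheme"
    and p :: "'g \<Rightarrow> 'k ^ ('n::{finite,linorder} + 'n) ^ ('n + 'n)"
    and \<omega> :: "'g \<Rightarrow> ('k ^ 'n::_ \<Rightarrow> complex) \<Rightarrow> 'k ^ 'n::_ \<Rightarrow> complex" +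
  fixes i :: nat
  assumes character: "smooth_additive_character \<psi>"
    and conductor: "has_conductor_2e v \<psi>"
    and haar: "self_dual_haar \<psi> \<mu>"
begin

text \<open>The scalars for which the \<open>e_basis j\<close> and \<open>c j *s f_basis j\<close>
  generate \<open>L\<close>. They carry the whole dependence on \<open>i\<close>, and both
  \<open>c j\<close> and \<open>\<pi> / c j\<close> are integral.\<close>

definition c :: "'n::_ \<Rightarrow> 'k" where
  "c j = (if card {..<j} < i then \<pi> else 1)"

abbreviation L :: "('k ^ ('n::_ + 'n)) set" where "L \<equiv> lattice_W v \<pi> i"

abbreviation L_dual :: "('k ^ ('n::_ + 'n)) set" where "L_dual \<equiv> dual_lattice v L"

abbreviation K :: "'g set" where "K \<equiv> stabilizer_K_cover v \<pi> Mp p i"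

abbreviation \<rho> :: "'k ^ ('n::_ + 'n) \<Rightarrow> ('k ^ 'n::_ \<Rightarrow> complex) \<Rightarrow> 'k ^ 'n::_ \<Rightarrow> complex" where
  "\<rho> u \<equiv> schroedinger \<psi> (u, 0)"

lemma c_nonzero [simp]: "c j \<noteq> 0"
  by (simp add: c_def)

lemma c_integral [simp]: "c j \<in> \<O>"
  by (simp add: c_def)

lemma uniformizer_div_c: "\<pi> / c j \<in> \<O>"
  by (simp add: c_def)

lemma uniformizer_power_int_integral: "m \<ge> 0 \<Longrightarrow> \<pi> powi m \<in> \<O>"
  by (simp add: integer_ring_def val_uniformizer_power_int)

lemma psi_add: "\<psi> (x + y) = \<psi> x * \<psi> y"
  using character by (simp add: smooth_additive_character_def)

lemma psi_nonzero [simp]: "\<psi> x \<noteq> 0"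
  using character by (simp add: smooth_additive_character_def)

lemma psi_0 [simp]: "\<psi> 0 = 1"
  using psi_add[of 0 0] by simp

lemma psi_uminus: "\<psi> (- x) = inverse (\<psi> x)"
  using psi_add[of x "- x"] by (simp add: field_simps)

lemma psi_diff: "\<psi> (x - y) = \<psi> x / \<psi> y"
  using psi_add[of x "- y"] by (simp add: psi_uminus divide_inverse)

lemma mem_four: "x \<in> (\<lambda>t. 4 * t) ` \<O> \<longleftrightarrow> x / 4 \<in> \<O>"
proof
  assume "x / 4 \<in> \<O>"
  then show "x \<in> (\<lambda>t. 4 * t) ` \<O>"
    using four_nonzero by (intro image_eqI[of _ _ "x / 4"]) simp_all
qed (use four_nonzero in auto)

lemma psi_trivial: "x / 4 \<in> \<O> \<Longrightarrow> \<psi> x = 1"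
  using conductor integer_ring_1 unfolding has_conductor_2e_def mem_four by fastforce

lemma psi_conductor: "(\<And>t. t \<in> \<O> \<Longrightarrow> \<psi> (t * x) = 1) \<Longrightarrow> x / 4 \<in> \<O>"
  using conductor unfolding has_conductor_2e_def mem_four by blast

lemma two_div_four: "2 * x / 4 = x / (2::'k)"
proof -
  have "2 * x / (2 * 2) = x / 2" using two_nonzero by (rule mult_divide_mult_cancel_left)
  then show ?thesis by simp
qed

lemma scalar_product_integral:
  assumes "\<And>j. x $ j * y $ j / t \<in> \<O>"
  shows "scalar_product x y / t \<in> \<O>"
  unfolding scalar_product_def sum_divide_distrib using assms by (intro integer_ring_sum) auto

text \<open>The coordinate conditions hold for the generators and survive integral combinations;
  conversely the coordinates of \<open>u\<close> are its coefficients.\<close>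

lemma lattice_W_iff: "u \<in> L \<longleftrightarrow> X_part u \<in> lat (\<lambda>_. 1) \<and> Y_part u \<in> lat c"
proof
  define B where "B = range e_basis \<union> range (\<lambda>j. c j *s f_basis j)"
  have L: "L = finite_span \<O> B"
    unfolding lattice_W_def B_def by (intro arg_cong2[where f = finite_span] arg_cong2[where f = "(\<union>)"] refl image_cong) (simp add: c_def)
  have fin: "finite B" by (simp add: B_def)
  have span: "(\<Sum>b\<in>B. d b *s b) \<in> L" if "\<forall>b\<in>B. d b \<in> \<O>" for d
    unfolding L finite_span_def using that by blast
  {
    assume "u \<in> L"
    then obtain d where d: "u = (\<Sum>b\<in>B. d b *s b)" "\<forall>b\<in>B. d b \<in> \<O>"
      unfolding L finite_span_def by auto
    have b: "b $ Inl j \<in> \<O> \<and> b $ Inr j / c j \<in> \<O>" if "b \<in> B" for b j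
      using that unfolding B_def by (auto simp: e_basis_def f_basis_def axis_def)
    have "u $ Inl j \<in> \<O>" "u $ Inr j / c j \<in> \<O>" for j
    proof -
      show "u $ Inl j \<in> \<O>"
        unfolding d(1) sum_component vector_smult_component using b d(2)
        by (intro integer_ring_sum integer_ring_mult) blast+
      have "(\<Sum>b\<in>B. d b * (b $ Inr j / c j)) \<in> \<O>"
        using b d(2) by (intro integer_ring_sum integer_ring_mult) blast+
      then show "u $ Inr j / c j \<in> \<O>"
        unfolding d(1) sum_component vector_smult_component sum_divide_distrib times_divide_eq_right .
    qed
    then show "X_part u \<in> lat (\<lambda>_. 1) \<and> Y_part u \<in> lat c"
      by (simp add: lat_def X_part_def Y_part_def)
  }
  \<comment> \<open>The span is indexed by the set \<open>B\<close> and the expansion of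
    \<open>u\<close> by basis indices. Closure under addition passes from one to the other without
    reindexing.\<close>
  have add: "x + y \<in> L" if "x \<in> L" "y \<in> L" for x y
  proof -
    obtain d where d: "x = (\<Sum>b\<in>B. d b *s b)" "\<forall>b\<in>B. d b \<in> \<O>"
      using \<open>x \<in> L\<close> unfolding L finite_span_def by blast
    obtain d' where d': "y = (\<Sum>b\<in>B. d' b *s b)" "\<forall>b\<in>B. d' b \<in> \<O>"
      using \<open>y \<in> L\<close> unfolding L finite_span_def by blast
    have "x + y = (\<Sum>b\<in>B. (d b + d' b) *s b)" "\<forall>b\<in>B. d b + d' b \<in> \<O>"
      using d d' by (simp_all add: sum.distrib vector_sadd_rdistrib integer_ring_add)
    then show ?thesis using span[of "\<lambda>b. d b + d' b"] by simp
  qed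
  have basis: "t *s b \<in> L" if "b \<in> B" "t \<in> \<O>" for b t
  proof -
    have "t *s b = (\<Sum>b'\<in>B. (if b' = b then t else 0) *s b')"
    proof -
      have "(\<Sum>b'\<in>B. (if b' = b then t else 0) *s b') = (\<Sum>b'\<in>B. if b' = b then t *s b else 0)"
        by (intro sum.cong) auto
      also have "\<dots> = t *s b" using that(1) fin by (simp only: sum.delta if_True)
      finally show ?thesis by simp
    qed
    moreover have "\<forall>b'\<in>B. (if b' = b then t else 0) \<in> \<O>" using that(2) by simp
    ultimately show ?thesis using span[of "\<lambda>b'. if b' = b then t else 0"] by simp
  qed
  have "0 \<in> L"
    using span[of "\<lambda>_. 0"] by simp
  then have sum: "sum f J \<in> L" if "\<And>j. j \<in> J \<Longrightarrow> f j \<in> L" for f and J :: "'n::_ set"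
    using that by (induction J rule: infinite_finite_induct) (auto intro: add)
  assume u: "X_part u \<in> lat (\<lambda>_. 1) \<and> Y_part u \<in> lat c"
  have u_eq: "u = (\<Sum>j\<in>UNIV. (X_part u $ j) *s e_basis j) + (\<Sum>j\<in>UNIV. (Y_part u $ j / c j) *s (c j *s f_basis j))"
    by (rule parts_eqI) (simp_all add: X_part_Y_part_add parts_sum sum_axis vector_smult_assoc)
  have X: "(\<Sum>j\<in>UNIV. (X_part u $ j) *s e_basis j) \<in> L"
    by (intro sum basis) (use u in \<open>auto simp: lat_def B_def\<close>)
  have Y: "(\<Sum>j\<in>UNIV. (Y_part u $ j / c j) *s (c j *s f_basis j)) \<in> L"
    by (intro sum basis) (use u in \<open>auto simp: lat_def B_def\<close>)
  show "u \<in> L" by (subst u_eq) (rule add[OF X Y])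
qed

text \<open>Pairing with the generators of \<open>L\<close> reads off the coordinates of
  \<open>w\<close>, scaled by 1 or \<open>c j\<close>; the converse is a termwise estimate of the
  form.\<close>

lemma dual_lattice_iff: "w \<in> L_dual \<longleftrightarrow> X_part w \<in> lat (\<lambda>j. 1 / c j) \<and> Y_part w \<in> lat (\<lambda>_. 1)"
proof
  assume w: "w \<in> L_dual"
  have "symp_form (e_basis j) w \<in> \<O>" "symp_form (c j *s f_basis j) w \<in> \<O>" for j
  proof -
    have "e_basis j \<in> L" "c j *s f_basis j \<in> L"
      by (auto simp: lattice_W_iff lat_def axis_def)
    then show "symp_form (e_basis j) w \<in> \<O>" "symp_form (c j *s f_basis j) w \<in> \<O>"
      using w by (auto simp: dual_lattice_def)
  qed
  then show "X_part w \<in> lat (\<lambda>j. 1 / c j) \<and> Y_part w \<in> lat (\<lambda>_. 1)"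
    by (simp add: symp_form_eq scalar_product_axis scalar_product_scale lat_def mult.commute)
next
  assume w: "X_part w \<in> lat (\<lambda>j. 1 / c j) \<and> Y_part w \<in> lat (\<lambda>_. 1)"
  show "w \<in> L_dual"
    unfolding dual_lattice_def
  proof (intro CollectI ballI)
    fix u assume u: "u \<in> L"
    have "X_part u $ j * Y_part w $ j / 1 \<in> \<O>" for j
      using u w by (auto simp: lattice_W_iff lat_def)
    moreover have "Y_part u $ j * X_part w $ j / 1 \<in> \<O>" for j
    proof -
      have "(Y_part u $ j / c j) * (X_part w $ j * c j) \<in> \<O>"
        by (rule integer_ring_mult) (use u w in \<open>auto simp: lattice_W_iff lat_def\<close>)
      then show ?thesis by simp
    qed
    ultimately show "symp_form u w \<in> \<O>"
      using scalar_product_integral[of "X_part u" "Y_part w" 1] scalar_product_integral[of "Y_part u" "X_part w" 1]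
      by (simp add: symp_form_eq integer_ring_diff)
  qed
qed

lemma lattice_Y_eq: "lattice_Y v \<pi> i = lat c"
  by (auto simp: lattice_Y_def lattice_W_iff lat_0)

lemma lattice_Y'_eq: "lattice_Y' v \<pi> i = (lat (\<lambda>_. 1) :: ('k ^ 'n::_) set)"
  by (auto simp: lattice_Y'_def dual_lattice_iff lat_0)

lemma scale_lat: "t \<noteq> 0 \<Longrightarrow> (\<lambda>y. t *s y) ` lat d = lat (\<lambda>j. t * d j)" for t :: 'k
proof (intro equalityI subsetI)
  fix y assume t: "t \<noteq> 0" and y: "y \<in> lat (\<lambda>j. t * d j)"
  then have "y = t *s (inverse t *s y)" "inverse t *s y \<in> lat d"
    by (auto simp: vector_smult_assoc lat_def field_simps)
  then show "y \<in> (\<lambda>y. t *s y) ` lat d" by blast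
qed (auto simp: lat_def)

lemma S_space_eq: "S_space v \<pi> i m = supported_invariant (lat (\<lambda>_. \<pi> powi - m)) (lat (\<lambda>j. 2 * \<pi> powi m * c j))"
  using two_nonzero by (simp add: S_space_def lattice_Y_eq lattice_Y'_eq scale_lat)

lemma S'_space_eq: "S'_space v \<pi> i m = supported_invariant (lat (\<lambda>j. \<pi> powi - m * c j)) (lat (\<lambda>_. 2 * \<pi> powi m))"
  using two_nonzero by (simp add: S'_space_def lattice_Y_eq lattice_Y'_eq scale_lat)

lemma supported_invariant_mono:
  "A \<subseteq> A' \<Longrightarrow> B' \<subseteq> B \<Longrightarrow> supported_invariant A B \<subseteq> supported_invariant A' B'"
  by (auto simp: supported_invariant_def)

lemma S_subset_S': "S_space v \<pi> i m \<subseteq> (S'_space v \<pi> i (m + 1) :: ('k ^ 'n::_ \<Rightarrow> complex) set)"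
  unfolding S_space_eq S'_space_eq
proof (rule supported_invariant_mono; rule lat_mono)
  fix j
  have "\<pi> powi - m / (\<pi> powi - (m + 1) * c j) = \<pi> / c j"
    unfolding power_int_minus by (simp add: power_int_add divide_inverse)
  then show "\<pi> powi - m / (\<pi> powi - (m + 1) * c j) \<in> \<O>" using uniformizer_div_c by simp
  have "2 * \<pi> powi (m + 1) / (2 * \<pi> powi m * c j) = \<pi> / c j"
    using two_nonzero by (simp add: power_int_add field_simps)
  then show "2 * \<pi> powi (m + 1) / (2 * \<pi> powi m * c j) \<in> \<O>" using uniformizer_div_c by simp
qed (use two_nonzero in auto)

lemma S'_subset_S: "S'_space v \<pi> i m \<subseteq> (S_space v \<pi> i m :: ('k ^ 'n::_ \<Rightarrow> complex) set)"
  unfolding S_space_eq S'_space_eq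
  using two_nonzero by (intro supported_invariant_mono lat_mono) simp_all

section \<open>Heisenberg operators and stability of the filtration\<close>

lemma schroedinger_apply:
  "\<rho> u \<phi> y = \<psi> (2 * scalar_product (X_part u) y - scalar_product (X_part u) (Y_part u)) * \<phi> (y - Y_part u)"
  by (simp add: schroedinger_def algebra_simps)

text \<open>Operators with \<open>X_part u = 0\<close> are translations and express the periods;
  those with \<open>Y_part u = 0\<close> multiply by characters and, by the conductor, express the
  support. The hypothesis \<open>ab\<close> makes the mixed phase
  \<open>\<psi> (- scalar_product (X_part u) (Y_part u))\<close> trivial, so both conditions combine
  in one lattice of vectors.\<close>

lemma supported_invariant_fixed:
  assumes a: "\<And>j. a j \<noteq> 0" and b: "\<And>j. b j \<noteq> 0" and ab: "\<And>j. b j / (2 * a j) \<in> \<O>"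
  shows "\<phi> \<in> supported_invariant (lat a) (lat b) \<longleftrightarrow>
    \<phi> \<in> schwartz \<and> (\<forall>u. X_part u \<in> lat (\<lambda>j. 2 / a j) \<and> Y_part u \<in> lat b \<longrightarrow> \<rho> u \<phi> = \<phi>)"
proof safe
  assume \<phi>: "\<phi> \<in> supported_invariant (lat a) (lat b)"
  then show "\<phi> \<in> schwartz" by (simp add: supported_invariant_def)
  fix u assume u: "X_part u \<in> lat (\<lambda>j. 2 / a j)" "Y_part u \<in> lat b"
  show "\<rho> u \<phi> = \<phi>"
  proof
    fix y
    let ?t = "2 * scalar_product (X_part u) y - scalar_product (X_part u) (Y_part u)"
    have inv: "\<phi> (y + - Y_part u) = \<phi> y"
      using \<phi> u(2) unfolding supported_invariant_def by (simp del: add_uminus_conv_diff)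
    show "\<rho> u \<phi> y = \<phi> y"
    proof (cases "\<phi> y = 0")
      case False
      then have y: "y \<in> lat a" using \<phi> by (auto simp: supported_invariant_def)
      have "X_part u $ j * y $ j / 2 \<in> \<O>" for j
      proof -
        have "(X_part u $ j / (2 / a j)) * (y $ j / a j) \<in> \<O>"
          by (rule integer_ring_mult) (use u y in \<open>simp_all only: lat_def mem_Collect_eq\<close>)
        then show ?thesis using a[of j] by (simp add: mult.commute)
      qed
      then have "scalar_product (X_part u) y / 2 \<in> \<O>"
        by (rule scalar_product_integral)
      moreover have "X_part u $ j * Y_part u $ j / 4 \<in> \<O>" for j
      proof -
        have "(X_part u $ j / (2 / a j)) * (Y_part u $ j / b j) * (b j / (2 * a j)) \<in> \<O>"
          by (intro integer_ring_mult) (use u ab in \<open>simp_all only: lat_def mem_Collect_eq\<close>)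
        moreover have "(X_part u $ j / (2 / a j)) * (Y_part u $ j / b j) * (b j / (2 * a j)) = X_part u $ j * Y_part u $ j / 4"
          using a[of j] b[of j] two_nonzero four_nonzero by (simp add: field_simps)
        ultimately show ?thesis by (simp only:)
      qed
      then have "scalar_product (X_part u) (Y_part u) / 4 \<in> \<O>"
        by (rule scalar_product_integral)
      moreover have "?t / 4 = scalar_product (X_part u) y / 2 - scalar_product (X_part u) (Y_part u) / 4"
        by (simp add: diff_divide_distrib two_div_four)
      ultimately have "?t / 4 \<in> \<O>" by (simp only: integer_ring_diff)
      then show ?thesis using inv by (simp add: schroedinger_apply psi_trivial)
    qed (use inv in \<open>simp add: schroedinger_apply\<close>)
  qed
next
  assume sch: "\<phi> \<in> schwartz"
    and fixed: "\<forall>u. X_part u \<in> lat (\<lambda>j. 2 / a j) \<and> Y_part u \<in> lat b \<longrightarrow> \<rho> u \<phi> = \<phi>"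
  have "\<phi> (y + t) = \<phi> y" if "t \<in> lat b" for y t
  proof -
    have "\<rho> (join_parts 0 (- t)) \<phi> = \<phi>"
      using fixed that by (simp add: lat_0)
    then have "\<rho> (join_parts 0 (- t)) \<phi> y = \<phi> y" by simp
    then show ?thesis by (simp add: schroedinger_apply)
  qed
  moreover have "y \<in> lat a" if y: "\<phi> y \<noteq> 0" for y
  proof -
    have "4 * (y $ j / a j) / 4 \<in> \<O>" for j
    proof (rule psi_conductor)
      fix s assume s: "s \<in> \<O>"
      \<comment> \<open>The phase of this operator at \<open>y\<close> is
        \<open>\<psi> (s * (4 * (y $ j / a j)))\<close>; it must be 1 for every integral
        \<open>s\<close>, which is the form the conductor condition needs.\<close>
      have "\<rho> (join_parts (axis j (2 * s / a j)) 0) \<phi> = \<phi>"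
        using fixed s a two_nonzero by (simp add: lat_def axis_def)
      then have "\<rho> (join_parts (axis j (2 * s / a j)) 0) \<phi> y = \<phi> y" by simp
      then have "\<psi> (2 * (2 * s / a j * y $ j)) = 1"
        using y by (simp add: schroedinger_apply scalar_product_axis)
      then show "\<psi> (s * (4 * (y $ j / a j))) = 1"
        by (simp add: algebra_simps)
    qed
    then show ?thesis using four_nonzero by (simp add: lat_def)
  qed
  ultimately show "\<phi> \<in> supported_invariant (lat a) (lat b)"
    using sch by (auto simp: supported_invariant_def)
qed

lemma K_carrier: "g \<in> K \<Longrightarrow> g \<in> carrier Mp"
  by (simp add: stabilizer_K_cover_def)

lemma symp_form_K: "g \<in> K \<Longrightarrow> symp_form (p g *v u) (p g *v w) = symp_form u w"
  by (simp add: stabilizer_K_cover_def stabilizer_K_def Sp_def)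

lemma K_image: "g \<in> K \<Longrightarrow> (\<lambda>u. p g *v u) ` L = L"
  by (simp add: stabilizer_K_cover_def stabilizer_K_def)

lemma K_surj: "g \<in> K \<Longrightarrow> \<exists>u. w = p g *v u"
proof -
  assume "g \<in> K"
  then have "invertible (p g)"
    by (simp add: stabilizer_K_cover_def stabilizer_K_def Sp_def)
  then obtain A where "p g ** A = mat 1" unfolding invertible_def by blast
  then have "w = p g *v (A *v w)" by (simp add: matrix_vector_mul_assoc)
  then show ?thesis by blast
qed

text \<open>\<open>p g\<close> preserves the form and maps \<open>L\<close> onto itself, so it
  preserves integrality of pairings with \<open>L\<close> in both directions.\<close>

lemma K_image_dual:
  assumes g: "g \<in> K"
  shows "(\<lambda>u. p g *v u) ` L_dual = L_dual"
proof (intro equalityI subsetI)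
  fix w assume "w \<in> (\<lambda>u. p g *v u) ` L_dual"
  then obtain w' where w': "w = p g *v w'" "w' \<in> L_dual" by blast
  show "w \<in> L_dual"
    unfolding dual_lattice_def
  proof (intro CollectI ballI)
    fix u assume "u \<in> L"
    then obtain u' where "u = p g *v u'" "u' \<in> L" using K_image[OF g] by blast
    then show "symp_form u w \<in> \<O>"
      using w' by (simp add: symp_form_K[OF g] dual_lattice_def)
  qed
next
  fix w assume w: "w \<in> L_dual"
  obtain w' where w': "w = p g *v w'" using K_surj[OF g] by blast
  have "w' \<in> L_dual"
    unfolding dual_lattice_def
  proof (intro CollectI ballI)
    fix u assume "u \<in> L"
    then have "p g *v u \<in> L" using K_image[OF g] by blast
    then have "symp_form (p g *v u) w \<in> \<O>" using w by (simp add: dual_lattice_def)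
    then show "symp_form u w' \<in> \<O>" by (simp add: w' symp_form_K[OF g])
  qed
  then show "w \<in> (\<lambda>u. p g *v u) ` L_dual" using w' by blast
qed

lemma omega_schwartz: "g \<in> carrier Mp \<Longrightarrow> \<phi> \<in> schwartz \<Longrightarrow> \<omega> g \<phi> \<in> schwartz"
  using representation by (simp add: representation_on_def)

text \<open>The condition on \<open>u\<close> says that \<open>u\<close> lies in \<open>t\<close>
  times \<open>M\<close>, a set permuted by \<open>p g\<close>. By the intertwining property,
  \<open>\<rho> (p g *v u)\<close> fixes \<open>\<omega> g \<phi>\<close> whenever
  \<open>\<rho> u\<close> fixes \<open>\<phi>\<close>.\<close>

lemma stable_fixed_vectors:
  assumes g: "g \<in> K" and M: "(\<lambda>u. p g *v u) ` M = M" and t: "t \<noteq> 0"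
    and \<phi>: "\<phi> \<in> schwartz" "\<forall>u. (1 / t) *s u \<in> M \<longrightarrow> \<rho> u \<phi> = \<phi>"
  shows "\<forall>u. (1 / t) *s u \<in> M \<longrightarrow> \<rho> u (\<omega> g \<phi>) = \<omega> g \<phi>"
proof (intro allI impI)
  fix u assume "(1 / t) *s u \<in> M"
  then obtain u' where u': "(1 / t) *s u = p g *v u'" "u' \<in> M" using M by blast
  then have "u = p g *v (t *s u')"
    using t by (simp add: vector_scalar_commute flip: u'(1))
  moreover have "(1 / t) *s (t *s u') \<in> M" using u'(2) t by (simp add: vector_smult_assoc)
  ultimately show "\<rho> u (\<omega> g \<phi>) = \<omega> g \<phi>"
    using lifts_projective[OF K_carrier[OF g] \<phi>(1), of "t *s u'" 0] \<phi>(2) by metis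
qed

lemma S_space_fixed:
  assumes "m \<ge> 0"
  shows "\<phi> \<in> S_space v \<pi> i m \<longleftrightarrow>
    \<phi> \<in> schwartz \<and> (\<forall>u. (1 / (2 * \<pi> powi m)) *s u \<in> L \<longrightarrow> \<rho> u \<phi> = \<phi>)"
proof -
  have "(\<pi> powi m)\<^sup>2 * c j \<in> \<O>" for j
    using assms by (intro integer_ring_mult integer_ring_power uniformizer_power_int_integral c_integral)
  \<comment> \<open>The integrality that trivialises the mixed phase; the quotient equals
    \<open>(\<pi> powi m)\<^sup>2 * c j\<close>, so \<open>m \<ge> 0\<close> is enough.\<close>
  then have *: "2 * \<pi> powi m * c j / (2 * \<pi> powi - m) \<in> \<O>" for j
    using two_nonzero by (simp add: power_int_minus power2_eq_square field_simps)
  have "(1 / (2 * \<pi> powi m)) *s u \<in> L \<longleftrightarrow> X_part u \<in> lat (\<lambda>j. 2 / \<pi> powi - m) \<and> Y_part u \<in> lat (\<lambda>j. 2 * \<pi> powi m * c j)" for u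
    unfolding lattice_W_iff lat_def mem_Collect_eq parts_scale vector_smult_component power_int_minus
    by (simp add: field_simps)
  then show ?thesis
    unfolding S_space_eq using two_nonzero
    by (subst supported_invariant_fixed[OF _ _ *]) simp_all
qed

lemma S'_space_fixed:
  assumes "m \<ge> 1"
  shows "\<phi> \<in> S'_space v \<pi> i m \<longleftrightarrow>
    \<phi> \<in> schwartz \<and> (\<forall>u. (1 / (2 * \<pi> powi m)) *s u \<in> L_dual \<longrightarrow> \<rho> u \<phi> = \<phi>)"
proof -
  \<comment> \<open>Here the division by \<open>c j\<close> costs one factor \<open>\<pi>\<close>,
    which leaves the exponent \<open>m - 1\<close> and explains the bound
    \<open>m \<ge> 1\<close>.\<close>
  have "(\<pi> powi (m - 1) * \<pi> powi m) * (\<pi> / c j) \<in> \<O>" for j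
    using assms by (intro integer_ring_mult uniformizer_power_int_integral uniformizer_div_c) simp_all
  moreover have "(\<pi> powi (m - 1) * \<pi> powi m) * (\<pi> / c j) = 2 * \<pi> powi m / (2 * (\<pi> powi - m * c j))" for j
    using two_nonzero by (simp add: power_int_minus power_int_diff field_simps)
  ultimately have *: "2 * \<pi> powi m / (2 * (\<pi> powi - m * c j)) \<in> \<O>" for j
    by (simp only:)
  have "(1 / (2 * \<pi> powi m)) *s u \<in> L_dual \<longleftrightarrow> X_part u \<in> lat (\<lambda>j. 2 / (\<pi> powi - m * c j)) \<and> Y_part u \<in> lat (\<lambda>j. 2 * \<pi> powi m)" for u
    unfolding dual_lattice_iff lat_def mem_Collect_eq parts_scale vector_smult_component power_int_minus
    by (simp add: field_simps)
  then show ?thesis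
    unfolding S'_space_eq using two_nonzero
    by (subst supported_invariant_fixed[OF _ _ *]) simp_all
qed

lemma stable_S: "m \<ge> 0 \<Longrightarrow> stable_under K \<omega> (S_space v \<pi> i m)"
  unfolding stable_under_def
  using stable_fixed_vectors[OF _ K_image, of _ "2 * \<pi> powi m"] omega_schwartz K_carrier two_nonzero
  by (simp add: S_space_fixed)

lemma stable_S': "m \<ge> 1 \<Longrightarrow> stable_under K \<omega> (S'_space v \<pi> i m)"
  unfolding stable_under_def
  using stable_fixed_vectors[OF _ K_image_dual, of _ "2 * \<pi> powi m"] omega_schwartz K_carrier two_nonzero
  by (simp add: S'_space_fixed)

end

section \<open>The space \<open>S0\<close> and its reflection\<close>

context weil_setup
begin

lemma lat_scale: "t \<in> \<O> \<Longrightarrow> y \<in> lat d \<Longrightarrow> t *s y \<in> lat d"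
  unfolding lat_def by (auto simp: times_divide_eq_right[symmetric] simp del: times_divide_eq_right)

abbreviation S0 :: "('k ^ 'n::_ \<Rightarrow> complex) set" where "S0 \<equiv> S_space v \<pi> i 0"

abbreviation unit_lat :: "('k ^ 'n::_) set" where "unit_lat \<equiv> lat (\<lambda>_. 1)"

abbreviation period_lat :: "('k ^ 'n::_) set" where "period_lat \<equiv> lat (\<lambda>j. 2 * c j)"

lemma period_subset_unit: "period_lat \<subseteq> unit_lat"
  using two_nonzero by (intro lat_mono) auto

lemma double_mem_period: "2 *s y \<in> period_lat \<longleftrightarrow> y \<in> lat c"
  using two_nonzero by (simp add: lat_def)

lemma S0_iff: "\<phi> \<in> S0 \<longleftrightarrow> (\<forall>y. \<phi> y \<noteq> 0 \<longrightarrow> y \<in> unit_lat) \<and> (\<forall>y. \<forall>t\<in>period_lat. \<phi> (y + t) = \<phi> y)"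
  unfolding S_space_eq using two_nonzero by (subst supported_invariant_lat) simp_all

lemma S0_support: "\<phi> \<in> S0 \<Longrightarrow> y \<notin> unit_lat \<Longrightarrow> \<phi> y = 0"
  unfolding S0_iff by blast

lemma S0_translate: "\<phi> \<in> S0 \<Longrightarrow> t \<in> period_lat \<Longrightarrow> \<phi> (y + t) = \<phi> y"
  unfolding S0_iff by blast

lemma S0I: "(\<And>y. y \<notin> unit_lat \<Longrightarrow> \<phi> y = 0) \<Longrightarrow> (\<And>y t. t \<in> period_lat \<Longrightarrow> \<phi> (y + t) = \<phi> y) \<Longrightarrow> \<phi> \<in> S0"
  unfolding S0_iff by blast

lemma S0_periodic: "\<phi> \<in> S0 \<Longrightarrow> y - z \<in> period_lat \<Longrightarrow> \<phi> y = \<phi> z"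
proof -
  assume "\<phi> \<in> S0" "y - z \<in> period_lat"
  then have "\<phi> (z + (y - z)) = \<phi> z" unfolding S0_iff by blast
  then show ?thesis by simp
qed

lemma S0_schwartz: "\<phi> \<in> S0 \<Longrightarrow> \<phi> \<in> schwartz"
  by (simp add: S_space_def supported_invariant_def)

lemma S0_subspace: "fun_subspace S0"
  unfolding fun_subspace_def by (auto intro!: S0I simp: S0_support S0_translate)

lemma S0_stable: "g \<in> K \<Longrightarrow> \<phi> \<in> S0 \<Longrightarrow> \<omega> g \<phi> \<in> S0"
  using stable_S[of 0] by (simp add: stable_under_def)

lemma S0_reflect: "\<phi> \<in> S0 \<Longrightarrow> (\<lambda>y. \<phi> (- y)) \<in> S0"
proof (rule S0I)
  fix y t assume "\<phi> \<in> S0" "t \<in> period_lat"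
  then have "\<phi> (- y + - t) = \<phi> (- y)" by (intro S0_translate lat_uminus)
  then show "\<phi> (- (y + t)) = \<phi> (- y)" by simp
qed (simp add: S0_support)

lemma omega_add: "g \<in> carrier Mp \<Longrightarrow> \<phi> \<in> schwartz \<Longrightarrow> \<eta> \<in> schwartz \<Longrightarrow> \<omega> g (\<lambda>y. \<phi> y + \<eta> y) = (\<lambda>y. \<omega> g \<phi> y + \<omega> g \<eta> y)"
  using representation by (simp add: representation_on_def)

lemma omega_scale: "g \<in> carrier Mp \<Longrightarrow> \<phi> \<in> schwartz \<Longrightarrow> \<omega> g (\<lambda>y. t * \<phi> y) = (\<lambda>y. t * \<omega> g \<phi> y)"
  using representation by (simp add: representation_on_def)

lemma omega_mult: "g \<in> carrier Mp \<Longrightarrow> h \<in> carrier Mp \<Longrightarrow> \<phi> \<in> schwartz \<Longrightarrow> \<omega> (g \<otimes>\<^bsub>Mp\<^esub> h) \<phi> = \<omega> g (\<omega> h \<phi>)"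
  using representation by (simp add: representation_on_def)

lemma fun_subspaceD:
  assumes "fun_subspace U"
  shows "(\<lambda>y. 0) \<in> U" "\<phi> \<in> U \<Longrightarrow> \<eta> \<in> U \<Longrightarrow> (\<lambda>y. \<phi> y + \<eta> y) \<in> U" "\<phi> \<in> U \<Longrightarrow> (\<lambda>y. t * \<phi> y) \<in> U"
  using assms by (auto simp: fun_subspace_def)

lemma fun_subspace_sum:
  assumes U: "fun_subspace U" and f: "\<And>j. j \<in> J \<Longrightarrow> f j \<in> U"
  shows "(\<lambda>y. \<Sum>j\<in>J. f j y) \<in> U"
  using f by (induction J rule: infinite_finite_induct) (simp_all add: fun_subspaceD[OF U])

lemma omega_sum:
  assumes g: "g \<in> carrier Mp" and f: "\<And>j. j \<in> J \<Longrightarrow> f j \<in> S0" and J: "finite J"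
  shows "\<omega> g (\<lambda>y. \<Sum>j\<in>J. f j y) = (\<lambda>y. \<Sum>j\<in>J. \<omega> g (f j) y)"
  using J f
proof (induction J rule: finite_induct)
  case empty
  have "(\<lambda>y. 0 :: complex) \<in> (schwartz :: ('k ^ 'n::_ \<Rightarrow> complex) set)" by (rule S0_schwartz[OF fun_subspaceD(1)[OF S0_subspace]])
  from omega_scale[OF g this, of 0] show ?case by simp
next
  case (insert j J)
  then have "f j \<in> schwartz" "(\<lambda>y. \<Sum>j\<in>J. f j y) \<in> schwartz"
    by (auto intro!: S0_schwartz fun_subspace_sum[OF S0_subspace])
  from omega_add[OF g this] insert show ?case by simp
qed

lemma schroedinger_double:
  "\<rho> (2 *s u) \<phi> y = \<psi> (4 * scalar_product (X_part u) (y - Y_part u)) * \<phi> (y - 2 *s Y_part u)"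
  by (simp add: schroedinger_apply scalar_product_scale scalar_product_linear algebra_simps)

text \<open>The translation part is integral, and the phase is periodic because vectors of
  \<open>period_lat\<close> pair integrally with \<open>X_part u\<close>, so that the factor 4 puts
  the change of argument in the kernel of \<open>\<psi>\<close>.\<close>

lemma S0_schroedinger:
  assumes u: "u \<in> L_dual" and \<phi>: "\<phi> \<in> S0"
  shows "\<rho> (2 *s u) \<phi> \<in> S0"
  unfolding S0_iff
proof (intro conjI allI ballI impI)
  have u: "X_part u \<in> lat (\<lambda>j. 1 / c j)" "Y_part u \<in> unit_lat" using u by (simp_all add: dual_lattice_iff)
  have Y: "2 *s Y_part u \<in> unit_lat" using u(2) by (auto simp: lat_def)
  fix y
  {
    assume "\<rho> (2 *s u) \<phi> y \<noteq> 0"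
    then have "y - 2 *s Y_part u \<in> unit_lat" using S0_support[OF \<phi>] by (auto simp: schroedinger_double)
    from lat_add[OF this Y] show "y \<in> unit_lat" by simp
  }
  fix t assume t: "t \<in> period_lat"
  have "X_part u $ j * t $ j / 1 \<in> \<O>" for j
  proof -
    have "(X_part u $ j / (1 / c j)) * (2 * (t $ j / (2 * c j))) \<in> \<O>"
      by (intro integer_ring_mult integer_ring_numeral) (use u(1) t in \<open>simp_all only: lat_def mem_Collect_eq\<close>)
    then show ?thesis using two_nonzero by simp
  qed
  then have "scalar_product (X_part u) t / 1 \<in> \<O>" by (rule scalar_product_integral)
  then have 1: "\<psi> (4 * scalar_product (X_part u) t) = 1"
    using four_nonzero by (intro psi_trivial) simp
  have eq: "y + t - Y_part u = (y - Y_part u) + t" "y + t - 2 *s Y_part u = (y - 2 *s Y_part u) + t"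
    by simp_all
  show "\<rho> (2 *s u) \<phi> (y + t) = \<rho> (2 *s u) \<phi> y"
    unfolding schroedinger_double eq S0_translate[OF \<phi> t]
    by (simp only: scalar_product_linear(2) distrib_left psi_add 1 mult_1_right)
qed

lemma scalar_product_dual: "x \<in> lat (\<lambda>j. 1 / c j) \<Longrightarrow> y \<in> lat c \<Longrightarrow> scalar_product x y \<in> \<O>"
proof -
  assume xy: "x \<in> lat (\<lambda>j. 1 / c j)" "y \<in> lat c"
  have "x $ j * y $ j / 1 \<in> \<O>" for j
  proof -
    have "(x $ j / (1 / c j)) * (y $ j / c j) \<in> \<O>"
      by (intro integer_ring_mult) (use xy in \<open>simp_all only: lat_def mem_Collect_eq\<close>)
    then show ?thesis by simp
  qed
  then show ?thesis using scalar_product_integral[of x y 1] by simp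
qed

text \<open>Some \<open>y $ j / c j\<close> is not integral, so the conductor provides an integral
  \<open>t\<close> with nontrivial character value; the witness is supported on that
  coordinate.\<close>

lemma dual_pairing_nondegenerate:
  assumes "y \<notin> lat c"
  shows "\<exists>x \<in> lat (\<lambda>j. 1 / c j). \<psi> (4 * scalar_product x y) \<noteq> 1"
proof -
  obtain j where j: "y $ j / c j \<notin> \<O>" using assms by (auto simp: lat_def)
  then have "4 * (y $ j / c j) / 4 \<notin> \<O>" using four_nonzero by simp
  then obtain t where t: "t \<in> \<O>" "\<psi> (t * (4 * (y $ j / c j))) \<noteq> 1"
    using psi_conductor by blast
  have "axis j (t / c j) \<in> lat (\<lambda>j. 1 / c j)" using t(1) by (auto simp: lat_def axis_def)
  moreover have "4 * scalar_product (axis j (t / c j)) y = t * (4 * (y $ j / c j))"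
    by (simp add: scalar_product_axis)
  ultimately show ?thesis using t(2) by metis
qed

text \<open>On \<open>S0\<close> the reflection \<open>\<phi> \<mapsto> \<phi> \<circ> uminus\<close> is a multiple of the sum of the Heisenberg operators over
  \<open>2 L_dual / 2 L\<close>; the stabiliser of \<open>L\<close> permutes the summands, hence commutes with the reflection.\<close>
lemma reflection_heisenberg_sum:
  "\<exists>R N. transversal L_dual L R \<and> N \<noteq> 0 \<and> (\<forall>\<phi>\<in>S0. \<forall>z. (\<Sum>r\<in>R. \<rho> (2 *s r) \<phi> z) = N * \<phi> (- z))"
proof -
  let ?D = "lat (\<lambda>j. 1 / c j)"
  \<comment> \<open>\<open>L_dual\<close> modulo \<open>L\<close> splits into an \<open>X\<close>
    part, represented by \<open>P\<close>, and a \<open>Y\<close> part, represented by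
    \<open>Q\<close>.\<close>
  obtain P where P: "transversal ?D unit_lat P" using lat_transversal[of "\<lambda>j. 1 / c j" "\<lambda>_. 1"] by auto
  obtain Q where Q: "transversal unit_lat (lat c) Q" using lat_transversal[of "\<lambda>_. 1" c] by auto
  define R where "R = (\<lambda>(x, y). join_parts x y) ` (P \<times> Q)"
  have inj: "inj_on (\<lambda>(x, y). join_parts x y) (P \<times> Q)"
    by (rule inj_on_inverseI[of _ "\<lambda>u. (X_part u, Y_part u)"]) auto
  have memR: "r \<in> R \<longleftrightarrow> X_part r \<in> P \<and> Y_part r \<in> Q" for r
  proof
    assume "X_part r \<in> P \<and> Y_part r \<in> Q"
    moreover have "r = join_parts (X_part r) (Y_part r)" by (rule parts_eqI) simp_all
    ultimately show "r \<in> R" unfolding R_def by force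
  qed (auto simp: R_def)
  have R: "transversal L_dual L R"
    unfolding transversal_def
  proof (intro conjI ballI)
    show "finite R" using P Q by (simp add: R_def transversal_def)
    show "R \<subseteq> L_dual" using P Q by (auto simp: memR dual_lattice_iff transversal_def)
    fix u assume u: "u \<in> L_dual"
    obtain x where x: "x \<in> P" "X_part u - x \<in> unit_lat" "\<And>x'. x' \<in> P \<Longrightarrow> X_part u - x' \<in> unit_lat \<Longrightarrow> x' = x"
      using P u unfolding transversal_def dual_lattice_iff by metis
    obtain y where y: "y \<in> Q" "Y_part u - y \<in> lat c" "\<And>y'. y' \<in> Q \<Longrightarrow> Y_part u - y' \<in> lat c \<Longrightarrow> y' = y"
      using Q u unfolding transversal_def dual_lattice_iff by metis
    show "\<exists>!r. r \<in> R \<and> u - r \<in> L"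
    proof
      show "join_parts x y \<in> R \<and> u - join_parts x y \<in> L"
        using x(1,2) y(1,2) by (simp add: memR lattice_W_iff parts_diff)
      fix r assume "r \<in> R \<and> u - r \<in> L"
      then show "r = join_parts x y"
        using x(3)[of "X_part r"] y(3)[of "Y_part r"] by (intro parts_eqI) (simp_all add: memR lattice_W_iff parts_diff)
    qed
  qed
  have "card P \<noteq> 0"
  proof -
    have "\<exists>r. r \<in> P" using P lat_0[of "\<lambda>j. 1 / c j"] unfolding transversal_def by blast
    then show ?thesis using P by (auto simp: transversal_def)
  qed
  moreover have "(\<Sum>r\<in>R. \<rho> (2 *s r) \<phi> z) = of_nat (card P) * \<phi> (- z)" if \<phi>: "\<phi> \<in> S0" for \<phi> z
  proof -
    have "(\<Sum>r\<in>R. \<rho> (2 *s r) \<phi> z) = (\<Sum>(x, y)\<in>P \<times> Q. \<rho> (2 *s join_parts x y) \<phi> z)"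
      unfolding R_def by (subst sum.reindex[OF inj]) (simp add: case_prod_unfold comp_def)
    also have "\<dots> = (\<Sum>y\<in>Q. \<Sum>x\<in>P. \<rho> (2 *s join_parts x y) \<phi> z)"
      by (simp add: sum.cartesian_product[symmetric]) (rule sum.swap)
    also have "\<dots> = (\<Sum>y\<in>Q. (\<Sum>x\<in>P. \<psi> (4 * scalar_product x (z - y))) * \<phi> (z - 2 *s y))"
      by (simp add: schroedinger_double sum_distrib_right)
    also have "\<dots> = of_nat (card P) * \<phi> (- z)"
    proof (cases "z \<in> unit_lat")
      case False
      have "\<phi> (z - 2 *s y) = 0" if "y \<in> Q" for y
      proof (rule S0_support[OF \<phi>])
        have "2 *s y \<in> unit_lat" using that Q by (intro lat_scale) (auto simp: transversal_def)
        then show "z - 2 *s y \<notin> unit_lat" using False lat_add[of "z - 2 *s y" "\<lambda>_. 1" "2 *s y"] by auto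
      qed
      moreover have "\<phi> (- z) = 0" using S0_support[OF \<phi>, of "- z"] False by simp
      ultimately show ?thesis by simp
    next
      case z: True
      \<comment> \<open>The inner sum is a full character sum over the \<open>X\<close> part and
        vanishes unless \<open>y\<close> is congruent to \<open>z\<close> modulo
        \<open>lat c\<close>. In that case \<open>z - 2 *s y\<close> is congruent to
        \<open>- z\<close> modulo the periods.\<close>
      have "(\<Sum>x\<in>P. \<psi> (4 * scalar_product x (z - y))) * \<phi> (z - 2 *s y)
          = (if z - y \<in> lat c then of_nat (card P) * \<phi> (- z) else 0)" if y: "y \<in> Q" for y
      proof (cases "z - y \<in> lat c")
        case True
        have "\<psi> (4 * scalar_product x (z - y)) = 1" if "x \<in> P" for x
          using scalar_product_dual[of x "z - y"] True that P four_nonzero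
          by (intro psi_trivial) (auto simp: transversal_def)
        moreover have "\<phi> (z - 2 *s y) = \<phi> (- z)"
        proof (rule S0_periodic[OF \<phi>])
          have "z - 2 *s y - - z = 2 *s (z - y)" by (simp add: vec_eq_iff)
          then show "z - 2 *s y - - z \<in> period_lat"
            using True by (simp only: double_mem_period)
        qed
        ultimately show ?thesis using True by simp
      next
        case False
        have zy: "z - y \<in> unit_lat" using z y Q by (intro lat_diff) (auto simp: transversal_def)
        obtain a where a: "a \<in> ?D" "\<psi> (4 * scalar_product a (z - y)) \<noteq> 1"
          using dual_pairing_nondegenerate[OF False] by blast
        have "(\<Sum>x\<in>P. \<psi> (4 * scalar_product x (z - y))) = 0"
        proof (rule sum_character_transversal[where \<kappa> = "\<lambda>x. \<psi> (4 * scalar_product x (z - y))",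
              OF lat_subgroup lat_subgroup _ P _ _ a])
          show "unit_lat \<subseteq> ?D" by (rule lat_mono) auto
          show "\<psi> (4 * scalar_product (x + x') (z - y))
              = \<psi> (4 * scalar_product x (z - y)) * \<psi> (4 * scalar_product x' (z - y))" for x x'
            unfolding scalar_product_linear(1) distrib_left psi_add ..
          fix x assume "x \<in> unit_lat"
          then have "x $ j * (z - y) $ j / 1 \<in> \<O>" for j
            using zy integer_ring_mult[of "x $ j" "(z - y) $ j"] by (simp add: lat_def)
          then have "scalar_product x (z - y) / 1 \<in> \<O>" by (rule scalar_product_integral)
          then show "\<psi> (4 * scalar_product x (z - y)) = 1"
            using four_nonzero by (intro psi_trivial) simp
        qed
        then show ?thesis using False by simp
      qed
      then have sum: "(\<Sum>y\<in>Q. (\<Sum>x\<in>P. \<psi> (4 * scalar_product x (z - y))) * \<phi> (z - 2 *s y))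
          = (\<Sum>y\<in>Q. if z - y \<in> lat c then of_nat (card P) * \<phi> (- z) else 0)"
        by (rule sum.cong[OF refl])
      obtain y0 where y0: "y0 \<in> Q" "\<And>y. y \<in> Q \<Longrightarrow> z - y \<in> lat c \<longleftrightarrow> y = y0"
        using Q z unfolding transversal_def by metis
      note sum
      also have "(\<Sum>y\<in>Q. if z - y \<in> lat c then of_nat (card P) * \<phi> (- z) else 0)
          = (\<Sum>y\<in>Q. if y = y0 then of_nat (card P) * \<phi> (- z) else 0)"
        using y0 by (intro sum.cong) auto
      also have "\<dots> = of_nat (card P) * \<phi> (- z)"
        using y0(1) Q by (simp add: transversal_def)
      finally show ?thesis .
    qed
    finally show ?thesis .
  qed
  ultimately show ?thesis using R by (intro exI[of _ R] exI[of _ "of_nat (card P)"]) simp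
qed

lemma L_subgroup: "additive_subgroup L"
  unfolding additive_subgroup_def by (auto simp: lattice_W_iff parts_diff lat_0 lat_diff)

text \<open>Write \<open>2 *s u\<close> as \<open>2 *s w\<close> plus an element of twice
  \<open>L\<close>, which fixes \<open>\<phi>\<close>. The central term of the Heisenberg product is
  4 times an integer by duality, so \<open>\<psi>\<close> does not see it.\<close>

lemma schroedinger_double_periodic:
  assumes \<phi>: "\<phi> \<in> S0" and u: "u \<in> L_dual" "w \<in> L_dual" "u - w \<in> L"
  shows "\<rho> (2 *s u) \<phi> = \<rho> (2 *s w) \<phi>"
proof -
  let ?l = "2 *s (u - w)"
  have "symp_form (u - w) w \<in> \<O>" using u by (simp add: dual_lattice_def)
  moreover have "symp_form (2 *s w) ?l = - (4 * symp_form (u - w) w)"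
    unfolding symp_form_eq parts_scale scalar_product_scale
      scalar_product_commute[of "X_part w"] scalar_product_commute[of "Y_part w"]
    by (simp add: right_diff_distrib)
  ultimately have 1: "\<psi> (symp_form (2 *s w) ?l) = 1"
    using four_nonzero by (intro psi_trivial) simp
  have "\<rho> ?l \<phi> = \<phi>"
    using \<phi> u(3) two_nonzero by (simp add: S_space_fixed vector_smult_assoc)
  then have "\<rho> (2 *s w) \<phi> = schroedinger \<psi> ((2 *s w, 0) \<otimes>\<^bsub>heisenberg\<^esub> (?l, 0)) \<phi>"
    using schroedinger_mult[of \<psi> "(2 *s w, 0)" "(?l, 0)" \<phi>] psi_add by simp
  also have "(2 *s w, 0) \<otimes>\<^bsub>heisenberg\<^esub> (?l, 0) = (2 *s u, symp_form (2 *s w) ?l)"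
    by (simp add: heisenberg_def vec_eq_iff)
  also have "schroedinger \<psi> (2 *s u, symp_form (2 *s w) ?l) \<phi> = \<rho> (2 *s u) \<phi>"
    using 1 by (simp add: schroedinger_def psi_add psi_diff psi_uminus fun_eq_iff divide_inverse)
  finally show ?thesis by simp
qed

text \<open>Moving \<open>\<omega> g\<close> through the Heisenberg sum replaces each
  \<open>r\<close> by \<open>p g *v r\<close>; this only permutes the classes of
  \<open>L_dual\<close> modulo \<open>L\<close>, on which the summands depend.\<close>

lemma omega_reflect:
  assumes g: "g \<in> K" and \<phi>: "\<phi> \<in> S0"
  shows "\<omega> g (\<lambda>y. \<phi> (- y)) = (\<lambda>y. \<omega> g \<phi> (- y))"
proof -
  obtain R N where R: "transversal L_dual L R" and N: "N \<noteq> 0"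
    and sum: "\<And>\<phi> z. \<phi> \<in> S0 \<Longrightarrow> (\<Sum>r\<in>R. \<rho> (2 *s r) \<phi> z) = N * \<phi> (- z)"
    using reflection_heisenberg_sum by blast
  have RL: "r \<in> L_dual" if "r \<in> R" for r using R that by (auto simp: transversal_def)
  have gM: "g \<in> carrier Mp" by (rule K_carrier[OF g])
  have \<phi>': "\<omega> g \<phi> \<in> S0" by (rule S0_stable[OF g \<phi>])
  have "\<omega> g (\<lambda>z. N * \<phi> (- z)) = \<omega> g (\<lambda>z. \<Sum>r\<in>R. \<rho> (2 *s r) \<phi> z)"
    using sum[OF \<phi>] by simp
  also have "\<dots> = (\<lambda>z. \<Sum>r\<in>R. \<omega> g (\<rho> (2 *s r) \<phi>) z)"
    using S0_schroedinger[OF RL \<phi>] R by (intro omega_sum[OF gM]) (auto simp: transversal_def)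
  also have "\<dots> = (\<lambda>z. \<Sum>r\<in>R. \<rho> (2 *s (p g *v r)) (\<omega> g \<phi>) z)"
    by (simp add: lifts_projective[OF gM S0_schwartz[OF \<phi>]] vector_scalar_commute)
  also have "\<dots> = (\<lambda>z. \<Sum>r\<in>R. \<rho> (2 *s r) (\<omega> g \<phi>) z)"
  proof
    fix z
    show "(\<Sum>r\<in>R. \<rho> (2 *s (p g *v r)) (\<omega> g \<phi>) z) = (\<Sum>r\<in>R. \<rho> (2 *s r) (\<omega> g \<phi>) z)"
    proof (rule sum_transversal_reindex[OF L_subgroup R])
      show "p g *v x \<in> L_dual" if "x \<in> L_dual" for x using K_image_dual[OF g] that by blast
      show "x - y \<in> L" if "p g *v x - p g *v y \<in> L" for x y
      proof -
        have "p g *v (x - y) \<in> L" using that by (simp add: matrix_vector_mult_diff_distrib)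
        then obtain l where l: "l \<in> L" "p g *v (x - y) = p g *v l" using K_image[OF g] by force
        have "invertible (p g)" using g by (simp add: stabilizer_K_cover_def stabilizer_K_def Sp_def)
        then obtain A where "A ** p g = mat 1" unfolding invertible_def by blast
        then have "x - y = l"
          using arg_cong[OF l(2), of "\<lambda>u. A *v u"] by (simp add: matrix_vector_mul_assoc)
        then show ?thesis using l(1) by simp
      qed
      show "\<rho> (2 *s x) (\<omega> g \<phi>) z = \<rho> (2 *s y) (\<omega> g \<phi>) z"
        if "x \<in> L_dual" "y \<in> L_dual" "x - y \<in> L" for x y
        using schroedinger_double_periodic[OF \<phi>' that] by simp
    qed
  qed
  also have "\<dots> = (\<lambda>z. N * \<omega> g \<phi> (- z))" using sum[OF \<phi>'] by simp
  finally have "(\<lambda>z. N * \<omega> g (\<lambda>y. \<phi> (- y)) z) = (\<lambda>z. N * \<omega> g \<phi> (- z))"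
    using omega_scale[OF gM S0_schwartz[OF S0_reflect[OF \<phi>]], of N] by simp
  then show ?thesis using N by (auto simp: fun_eq_iff)
qed

end

section \<open>Quadratic characters coming from unipotent elements of the stabilizer\<close>

lemma scalar_product_outer:
  "scalar_product y ((\<chi> r s. t * x $ r * x $ s) *v y) = t * (scalar_product x y)\<^sup>2"
  for y :: "'k::field ^ 'n::finite"
proof -
  have "((\<chi> r s. t * x $ r * x $ s) *v y) = (t * scalar_product x y) *s x"
    by (simp add: matrix_vector_mult_def vec_eq_iff scalar_product_def sum_distrib_left sum_distrib_right mult_ac)
  then show ?thesis
    by (simp add: scalar_product_scale scalar_product_commute power2_eq_square mult_ac)
qed

lemma block_matrix_join:
  "block_matrix a b d e *v u = join_parts (a *v X_part u + b *v Y_part u) (d *v X_part u + e *v Y_part u)"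
  for a :: "'k::field ^ 'n ^ 'n::finite"
  by (rule parts_eqI) (simp_all add: block_matrix_vector)

context weil_setup
begin

text \<open>Symmetric matrices mapping \<open>lat c\<close> into \<open>unit_lat\<close>, which is
  what makes the upper triangular unipotent matrix with block \<open>a\<close> stabilise
  \<open>L\<close>.\<close>

definition unipotent_stabilizer :: "('k ^ 'n::_ ^ 'n::_) set" where
  "unipotent_stabilizer = {a. transpose a = a \<and> (\<forall>r s. a $ r $ s * c s \<in> \<O>)}"

text \<open>The rank one matrices \<open>t x x\<^sup>T\<close> with \<open>x = e\<^sub>j + e\<^sub>k\<close> suffice: they determine \<open>(y\<^sub>j + y\<^sub>k)\<^sup>2\<close> modulo \<open>4 \<pi>\<close>, hence
  \<open>y\<^sub>j + y\<^sub>k\<close> modulo \<open>2 \<pi>\<close> up to sign, which forces the signs of all coordinates to agree.\<close>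
lemma quadratic_form_separates:
  assumes y: "y \<in> unit_lat" and z: "z \<in> unit_lat"
    and eq: "\<And>a. a \<in> unipotent_stabilizer \<Longrightarrow> \<psi> (scalar_product y (a *v y)) = \<psi> (scalar_product z (a *v z))"
  shows "y - z \<in> period_lat \<or> y + z \<in> period_lat"
proof -
  have yO: "y $ j \<in> \<O>" and zO: "z $ j \<in> \<O>" for j
    using y z by (simp_all add: lat_def)
  \<comment> \<open>The matrices \<open>(t / d)\<close> times the outer square of \<open>x\<close>
    are admissible for all integral \<open>t\<close>; varying \<open>t\<close> turns equality of
    character values into divisibility by \<open>4 * d\<close>.\<close>
  have rank_one: "((scalar_product x y)\<^sup>2 - (scalar_product x z)\<^sup>2) / (4 * d) \<in> \<O>"
    if d: "d \<noteq> 0" and x: "\<And>j. x $ j \<in> \<O>" "\<And>r s. x $ r * x $ s * (c s / d) \<in> \<O>" for d x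
  proof -
    have "((scalar_product x y)\<^sup>2 - (scalar_product x z)\<^sup>2) / d / 4 \<in> \<O>"
    proof (rule psi_conductor)
      fix t assume t: "t \<in> \<O>"
      let ?a = "(\<chi> r s. (t / d) * x $ r * x $ s) :: 'k ^ 'n::_ ^ 'n::_"
      have "?a \<in> unipotent_stabilizer"
        unfolding unipotent_stabilizer_def
      proof (intro CollectI conjI allI)
        show "transpose ?a = ?a" by (simp add: transpose_def vec_eq_iff mult_ac)
        fix r s
        have "t * (x $ r * x $ s * (c s / d)) \<in> \<O>" using t x(2) by blast
        then show "?a $ r $ s * c s \<in> \<O>" by (simp add: mult_ac)
      qed
      from eq[OF this] have "\<psi> (t / d * (scalar_product x y)\<^sup>2 - t / d * (scalar_product x z)\<^sup>2) = 1"
        unfolding scalar_product_outer psi_diff by simp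
      then show "\<psi> (t * (((scalar_product x y)\<^sup>2 - (scalar_product x z)\<^sup>2) / d)) = 1"
        by (simp add: algebra_simps diff_divide_distrib)
    qed
    then show ?thesis by (simp add: mult.commute)
  qed
  have sq: "((y $ j)\<^sup>2 - (z $ j)\<^sup>2) / (4 * c j) \<in> \<O>" for j
  proof -
    let ?x = "axis j 1 :: 'k ^ 'n::_"
    have "?x $ r * ?x $ s * (c s / c j) \<in> \<O>" "?x $ r \<in> \<O>" for r s
      by (auto simp: axis_def)
    then show ?thesis using rank_one[of "c j" ?x] by (simp add: scalar_product_axis)
  qed
  have both: "(y $ j - z $ j) / (2 * c j) \<in> \<O> \<and> (y $ j + z $ j) / (2 * c j) \<in> \<O>" if "c j = 1" for j
    using half_diff_integral[OF zO[of j], of "y $ j"] sq[of j] that by simp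
  have sign: "(y $ j - z $ j) / (2 * \<pi>) \<in> \<O> \<or> (y $ j + z $ j) / (2 * \<pi>) \<in> \<O>" if "c j = \<pi>" for j
    using half_diff_divisible[OF zO[of j], of "y $ j"] sq[of j] that by simp
  have sign2: "(y $ j + y $ k - (z $ j + z $ k)) / (2 * \<pi>) \<in> \<O> \<or> (y $ j + y $ k + (z $ j + z $ k)) / (2 * \<pi>) \<in> \<O>"
    if jk: "c j = \<pi>" "c k = \<pi>" "j \<noteq> k" for j k
  proof -
    let ?x = "axis j 1 + axis k 1 :: 'k ^ 'n::_"
    have "?x $ r * ?x $ s * (c s / \<pi>) \<in> \<O>" "?x $ r \<in> \<O>" for r s
      using jk by (auto simp: axis_def)
    then have "((y $ j + y $ k)\<^sup>2 - (z $ j + z $ k)\<^sup>2) / (4 * \<pi>) \<in> \<O>"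
      using rank_one[of \<pi> ?x] by (simp add: scalar_product_linear scalar_product_axis)
    then show ?thesis
      using half_diff_divisible[of "z $ j + z $ k" "y $ j + y $ k"] zO by blast
  qed
  show ?thesis
  proof (cases "y - z \<in> period_lat")
    case False
    \<comment> \<open>At \<open>k\<close> only the sign minus is possible. Any coordinate
      \<open>j\<close> admitting only the sign plus would contradict \<open>sign2\<close> for the
      pair \<open>j\<close>, \<open>k\<close>, so minus works everywhere.\<close>
    then obtain k where k: "(y $ k - z $ k) / (2 * c k) \<notin> \<O>"
      by (auto simp: lat_def)
    have ck: "c k = \<pi>" using both[of k] k by (auto simp: c_def split: if_splits)
    have k': "(y $ k + z $ k) / (2 * \<pi>) \<in> \<O>" using sign[OF ck] k ck by simp
    have "(y $ j + z $ j) / (2 * c j) \<in> \<O>" for j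
    proof (cases "c j = 1")
      case False
      then have cj: "c j = \<pi>" by (auto simp: c_def)
      show ?thesis
      proof (rule ccontr)
        assume n: "\<not> ?thesis"
        then have j: "(y $ j + z $ j) / (2 * \<pi>) \<notin> \<O>" using cj by simp
        then have j': "(y $ j - z $ j) / (2 * \<pi>) \<in> \<O>" using sign[OF cj] by blast
        have "j \<noteq> k" using j k' by blast
        from sign2[OF cj ck this] show False
        proof
          assume "(y $ j + y $ k - (z $ j + z $ k)) / (2 * \<pi>) \<in> \<O>"
          from integer_ring_diff[OF this j'] have "(y $ k - z $ k) / (2 * \<pi>) \<in> \<O>"
            by (simp add: diff_divide_distrib add_divide_distrib)
          then show False using k ck by simp
        next
          assume "(y $ j + y $ k + (z $ j + z $ k)) / (2 * \<pi>) \<in> \<O>"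
          from integer_ring_diff[OF this k'] have "(y $ j + z $ j) / (2 * \<pi>) \<in> \<O>"
            by (simp add: add_divide_distrib)
          then show False using j by simp
        qed
      qed
    qed (use both in blast)
    then show ?thesis by (simp add: lat_def)
  qed blast
qed

lemma K_I:
  assumes "g \<in> carrier Mp" "\<And>u. u \<in> L \<Longrightarrow> p g *v u \<in> L" "\<And>u. u \<in> L \<Longrightarrow> \<exists>u'\<in>L. u = p g *v u'"
  shows "g \<in> K"
proof -
  have "p \<in> hom Mp Sp" using extension by (simp add: two_fold_central_extension_def)
  then have "p g \<in> carrier Sp" using assms(1) by (auto simp: hom_def)
  moreover have "(\<lambda>u. p g *v u) ` L = L" using assms(2,3) by blast
  ultimately show ?thesis using assms(1) by (simp add: stabilizer_K_cover_def stabilizer_K_def)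
qed

lemma unipotent_lift:
  assumes a: "a \<in> unipotent_stabilizer"
  shows "\<exists>g\<in>K. \<forall>\<phi>\<in>schwartz. \<omega> g \<phi> = (\<lambda>y. \<psi> (scalar_product y (a *v y)) * \<phi> y)"
proof -
  have "transpose a = a" using a by (simp add: unipotent_stabilizer_def)
  then obtain g where g: "g \<in> carrier Mp" "p g = block_matrix (mat 1) a 0 (mat 1)"
    "\<forall>\<phi>\<in>schwartz. \<omega> g \<phi> = (\<lambda>y. \<psi> (scalar_product y (a *v y)) * \<phi> y)"
    using formula_x by blast
  have pg: "p g *v u = join_parts (X_part u + a *v Y_part u) (Y_part u)" for u
    unfolding g(2) block_matrix_join by simp
  have aY: "a *v y \<in> unit_lat" if "y \<in> lat c" for y
  proof -
    have "(\<Sum>s\<in>UNIV. a $ r $ s * c s * (y $ s / c s)) \<in> \<O>" for r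
      using a that by (intro integer_ring_sum integer_ring_mult[of "_ * _" "_ / _"])
        (simp_all add: unipotent_stabilizer_def lat_def)
    then show ?thesis by (simp add: lat_def matrix_vector_mult_def)
  qed
  have "g \<in> K"
  proof (rule K_I[OF g(1)])
    fix u assume u: "u \<in> L"
    then show "p g *v u \<in> L" by (simp add: pg lattice_W_iff lat_add aY)
    let ?u = "join_parts (X_part u - a *v Y_part u) (Y_part u)"
    have "?u \<in> L" using u by (simp add: lattice_W_iff lat_diff aY)
    moreover have "u = p g *v ?u" unfolding pg by (rule parts_eqI) simp_all
    ultimately show "\<exists>u'\<in>L. u = p g *v u'" by blast
  qed
  then show ?thesis using g(3) by blast
qed

section \<open>Parity parts and symmetrised coset indicators\<close>

text \<open>Carrying the sign as a parameter lets one argument treat the even and the odd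
  case.\<close>

definition parity_part :: "complex \<Rightarrow> ('k ^ 'n::_ \<Rightarrow> complex) set" where
  "parity_part \<epsilon> = {\<phi> \<in> S0. \<forall>y. \<phi> (- y) = \<epsilon> * \<phi> y}"

lemma even_part_eq: "even_part S0 = parity_part 1"
  by (simp add: even_part_def parity_part_def)

lemma odd_part_eq: "odd_part S0 = parity_part (- 1)"
  by (simp add: odd_part_def parity_part_def)

lemma parity_partD:
  assumes "\<phi> \<in> parity_part \<epsilon>"
  shows "\<phi> \<in> S0" "\<phi> (- y) = \<epsilon> * \<phi> y"
  using assms by (auto simp: parity_part_def)

lemma parity_part_subspace: "fun_subspace (parity_part \<epsilon>)"
  unfolding fun_subspace_def parity_part_def
  by (auto simp: fun_subspaceD[OF S0_subspace] algebra_simps)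

lemma parity_part_stable: "stable_under K \<omega> (parity_part \<epsilon>)"
  unfolding stable_under_def
proof (intro ballI)
  fix g \<phi> assume g: "g \<in> K" and \<phi>: "\<phi> \<in> parity_part \<epsilon>"
  have S: "\<phi> \<in> S0" by (rule parity_partD(1)[OF \<phi>])
  have "(\<lambda>y. \<omega> g \<phi> (- y)) = \<omega> g (\<lambda>y. \<phi> (- y))" by (rule omega_reflect[OF g S, symmetric])
  also have "\<dots> = (\<lambda>y. \<epsilon> * \<omega> g \<phi> y)"
    unfolding parity_partD(2)[OF \<phi>] by (rule omega_scale[OF K_carrier[OF g] S0_schwartz[OF S]])
  finally show "\<omega> g \<phi> \<in> parity_part \<epsilon>"
    using S0_stable[OF g S] by (simp add: parity_part_def fun_eq_iff)
qed

definition ind :: "'k ^ 'n::_ \<Rightarrow> 'k ^ 'n::_ \<Rightarrow> complex" where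
  "ind y z = (if z - y \<in> period_lat then 1 else 0)"

text \<open>When \<open>y\<close> and \<open>- y\<close> are congruent modulo
  \<open>period_lat\<close>, this degenerates to \<open>1 + \<epsilon>\<close> times the indicator:
  twice it in the even case, zero in the odd case.\<close>

definition delta :: "complex \<Rightarrow> 'k ^ 'n::_ \<Rightarrow> 'k ^ 'n::_ \<Rightarrow> complex" where
  "delta \<epsilon> y z = ind y z + \<epsilon> * ind (- y) z"

lemma ind_S0:
  assumes y: "y \<in> unit_lat"
  shows "ind y \<in> S0"
proof (rule S0I)
  fix z assume "z \<notin> unit_lat"
  then have "z - y \<notin> unit_lat" using lat_add[of "z - y" "\<lambda>_. 1" y] y by auto
  then show "ind y z = 0" using period_subset_unit by (auto simp: ind_def)
next
  fix z t assume t: "t \<in> period_lat"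
  have "z + t - y \<in> period_lat \<longleftrightarrow> z - y \<in> period_lat"
    using lat_add[of "z - y" _ t] lat_diff[of "z + t - y" _ t] t by (auto simp: algebra_simps)
  then show "ind y (z + t) = ind y z" by (simp add: ind_def)
qed

lemma ind_reflect: "ind (- y) z = ind y (- z)"
proof -
  have "z - - y = - (- z - y)" by simp
  then show ?thesis unfolding ind_def by (simp only: lat_uminus_iff)
qed

lemma delta_S0: "y \<in> unit_lat \<Longrightarrow> delta \<epsilon> y \<in> S0"
  unfolding delta_def by (intro fun_subspaceD[OF S0_subspace] ind_S0) simp_all

lemma delta_parity: "y \<in> unit_lat \<Longrightarrow> \<epsilon> * \<epsilon> = 1 \<Longrightarrow> delta \<epsilon> y \<in> parity_part \<epsilon>"
  using delta_S0[of y \<epsilon>] by (simp add: parity_part_def delta_def ind_reflect[of y] algebra_simps)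

end

section \<open>Invariant subspaces of a parity part\<close>

locale parity_subrep = weil_setup v \<pi> \<psi> \<mu> Mp p \<omega> i
  for v :: "'k::{field,complete_space} \<Rightarrow> int"
    and \<pi> :: 'k
    and \<psi> :: "'k \<Rightarrow> complex"
    and \<mu> :: "('k ^ 'n::{finite,linorder}) measure"
    and Mp :: "('g, 'b) monoid_scheme"
    and p :: "'g \<Rightarrow> 'k ^ ('n::{finite,linorder} + 'n) ^ ('n + 'n)"
    and \<omega> :: "'g \<Rightarrow> ('k ^ 'n::_ \<Rightarrow> complex) \<Rightarrow> 'k ^ 'n::_ \<Rightarrow> complex"
    and i :: nat +
  fixes \<epsilon> :: complex and V :: "('k ^ 'n::_ \<Rightarrow> complex) set"
  assumes sign_square: "\<epsilon> * \<epsilon> = 1"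
    and V_subspace: "fun_subspace V"
    and V_subset: "V \<subseteq> parity_part \<epsilon>"
    and V_stable: "stable_under K \<omega> V"
begin

lemma V_S0: "\<phi> \<in> V \<Longrightarrow> \<phi> \<in> S0"
  using V_subset parity_partD(1) by blast

lemma V_omega: "g \<in> K \<Longrightarrow> \<phi> \<in> V \<Longrightarrow> \<omega> g \<phi> \<in> V"
  using V_stable by (simp add: stable_under_def)

text \<open>A unipotent element multiplies by a character whose values at \<open>y\<close> and at
  \<open>z\<close> differ. Subtracting its value at \<open>z\<close> kills the value there, keeps
  earlier zeros, and changes the value at \<open>y\<close> by the nonzero factor \<open>d\<close>,
  which is then divided out.\<close>

lemma separate_from_finite:
  assumes \<phi>: "\<phi> \<in> V" and y: "y \<in> unit_lat"
    and F: "finite F" "\<And>z. z \<in> F \<Longrightarrow> z \<in> unit_lat \<and> y - z \<notin> period_lat \<and> y + z \<notin> period_lat"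
  shows "\<exists>\<eta>\<in>V. \<eta> y = \<phi> y \<and> (\<forall>z\<in>F. \<eta> z = 0)"
  using F
proof (induction F rule: finite_induct)
  case empty
  then show ?case using \<phi> by blast
next
  case (insert z F)
  then obtain \<eta> where \<eta>: "\<eta> \<in> V" "\<eta> y = \<phi> y" "\<forall>z\<in>F. \<eta> z = 0" by auto
  let ?q = "\<lambda>a y. \<psi> (scalar_product y (a *v y))"
  have "z \<in> unit_lat" "\<not> (y - z \<in> period_lat \<or> y + z \<in> period_lat)" using insert.prems by auto
  then obtain a where a: "a \<in> unipotent_stabilizer" "?q a y \<noteq> ?q a z"
    using quadratic_form_separates[OF y] by blast
  obtain g where g: "g \<in> K" "\<forall>\<phi>\<in>schwartz. \<omega> g \<phi> = (\<lambda>y. ?q a y * \<phi> y)"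
    using unipotent_lift[OF a(1)] by blast
  have g\<eta>: "\<omega> g \<eta> = (\<lambda>y. ?q a y * \<eta> y)" using g(2) S0_schwartz[OF V_S0[OF \<eta>(1)]] by blast
  define d where "d = ?q a y - ?q a z"
  have "(\<lambda>x. (1 / d) * (\<omega> g \<eta> x + (- ?q a z) * \<eta> x)) \<in> V"
    by (intro fun_subspaceD[OF V_subspace] V_omega g(1) \<eta>(1))
  moreover have "(1 / d) * (\<omega> g \<eta> y + (- ?q a z) * \<eta> y) = \<phi> y"
  proof -
    have "\<omega> g \<eta> y + (- ?q a z) * \<eta> y = d * \<phi> y" by (simp add: g\<eta> \<eta>(2) d_def algebra_simps)
    then show ?thesis using a(2) by (simp add: d_def)
  qed
  moreover have "\<forall>x\<in>insert z F. (1 / d) * (\<omega> g \<eta> x + (- ?q a z) * \<eta> x) = 0"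
    using \<eta>(3) by (auto simp: g\<eta>)
  ultimately show ?case by (intro bexI[of _ "\<lambda>x. (1 / d) * (\<omega> g \<eta> x + (- ?q a z) * \<eta> x)"] conjI)
qed

text \<open>Separating \<open>y\<close> from representatives of all classes other than those of
  \<open>y\<close> and \<open>- y\<close> leaves a function supported on these two classes; its
  parity makes it proportional to \<open>delta \<epsilon> y\<close>.\<close>

lemma delta_mem:
  assumes \<phi>: "\<phi> \<in> V" and y: "y \<in> unit_lat" "\<phi> y \<noteq> 0"
  shows "delta \<epsilon> y \<in> V"
proof -
  obtain R where R: "transversal unit_lat period_lat R"
    using lat_transversal[of "\<lambda>_. 1" "\<lambda>j. 2 * c j"] two_nonzero by auto
  define F where "F = {z \<in> R. y - z \<notin> period_lat \<and> y + z \<notin> period_lat}"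
  have "finite F" "\<And>z. z \<in> F \<Longrightarrow> z \<in> unit_lat \<and> y - z \<notin> period_lat \<and> y + z \<notin> period_lat"
    using R by (auto simp: F_def transversal_def)
  then obtain \<eta> where \<eta>: "\<eta> \<in> V" "\<eta> y = \<phi> y" "\<forall>z\<in>F. \<eta> z = 0"
    using separate_from_finite[OF \<phi> y(1)] by blast
  have S: "\<eta> \<in> S0" by (rule V_S0[OF \<eta>(1)])
  have refl: "\<eta> (- x) = \<epsilon> * \<eta> x" for x using V_subset \<eta>(1) parity_partD(2) by blast
  have zero: "\<eta> z = 0" if z: "z - y \<notin> period_lat" "z - - y \<notin> period_lat" for z
  proof (cases "z \<in> unit_lat")
    case True
    then obtain r where r: "r \<in> R" "z - r \<in> period_lat" using R unfolding transversal_def by blast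
    have "y - r \<notin> period_lat"
      using lat_diff[of "z - r" _ "y - r"] r(2) z(1) by auto
    moreover have "y + r \<notin> period_lat"
      using lat_add[of "z - r" _ "y + r"] r(2) z(2) by (auto simp: add.commute)
    ultimately have "\<eta> r = 0" using \<eta>(3) r(1) by (simp add: F_def)
    then show ?thesis using S0_periodic[OF S r(2)] by simp
  qed (simp add: S0_support[OF S])
  \<comment> \<open>If the two classes coincide, \<open>\<phi> y \<noteq> 0\<close> forces
    \<open>\<epsilon> = 1\<close>, and both indicators contribute to \<open>delta\<close> at
    \<open>y\<close>; hence the 2.\<close>
  define t where "t = (if y - - y \<in> period_lat then 2 / \<phi> y else 1 / \<phi> y)"
  have "delta \<epsilon> y z = t * \<eta> z" for z
  proof (cases "z - y \<in> period_lat")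
    case True
    then have \<eta>z: "\<eta> z = \<phi> y" using S0_periodic[OF S True] \<eta>(2) by simp
    show ?thesis
    proof (cases "y - - y \<in> period_lat")
      case per: True
      have "\<phi> y = \<epsilon> * \<phi> y" using S0_periodic[OF S per] refl[of y] \<eta>(2) by simp
      then have "\<epsilon> = 1" using y(2) by simp
      moreover have "z - - y \<in> period_lat" using lat_add[OF True per] by (simp add: add.commute)
      ultimately show ?thesis using True per y(2) \<eta>z by (simp add: delta_def ind_def t_def)
    next
      case False
      then have "z - - y \<notin> period_lat" using lat_diff[of "z - - y" _ "z - y"] True by auto
      then show ?thesis using True False y(2) \<eta>z by (simp add: delta_def ind_def t_def)
    qed
  next
    case n: False
    show ?thesis
    proof (cases "z - - y \<in> period_lat")
      case True
      then have "\<eta> z = \<epsilon> * \<phi> y" using S0_periodic[OF S True] refl[of y] \<eta>(2) by simp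
      moreover have "y - - y \<notin> period_lat" using lat_diff[of "z - - y" _ "y - - y"] True n by auto
      ultimately show ?thesis using True n y(2) by (simp add: delta_def ind_def t_def)
    next
      case False
      then show ?thesis using n zero by (simp add: delta_def ind_def)
    qed
  qed
  then have "delta \<epsilon> y = (\<lambda>z. t * \<eta> z)" by blast
  then show ?thesis using fun_subspaceD(3)[OF V_subspace \<eta>(1)] by simp
qed

end

section \<open>Haar measure and the rescaled Fourier transform\<close>

lemma matrix_inv_eq:
  fixes A B :: "'k::field ^ 'n ^ 'n::finite"
  assumes "A ** B = mat 1" "B ** A = mat 1"
  shows "matrix_inv A = B"
proof -
  have "A ** matrix_inv A = mat 1 \<and> matrix_inv A ** A = mat 1"
    unfolding matrix_inv_def by (rule someI[of _ B]) (use assms in simp)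
  then have "B ** (A ** matrix_inv A) = B" by simp
  then show ?thesis using assms(2) by (simp add: matrix_mul_assoc)
qed

context weil_setup
begin

lemma haar_sets: "sets \<mu> = sets borel"
  using haar by (simp add: self_dual_haar_def)

lemma haar_space: "space \<mu> = UNIV"
  using sets_eq_imp_space_eq[OF haar_sets] by simp

lemma haar_inversion: "\<phi> \<in> schwartz \<Longrightarrow> fourier \<psi> \<mu> (fourier \<psi> \<mu> \<phi>) (- y) = \<phi> y"
  using haar by (simp add: self_dual_haar_def)

lemma haar_compact: "compact C \<Longrightarrow> emeasure \<mu> C < \<infinity>"
  using haar by (simp add: self_dual_haar_def)

lemma haar_translate: "A \<in> sets borel \<Longrightarrow> emeasure \<mu> ((\<lambda>y. t + y) ` A) = emeasure \<mu> A"
  using haar by (simp add: self_dual_haar_def)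

lemma closed_period_lat: "closed period_lat" and compact_period_lat: "compact period_lat"
  using two_nonzero by (auto intro!: closed_lat compact_lat)

lemma measure_period_coset: "measure \<mu> {v. v - y \<in> period_lat} = measure \<mu> period_lat"
proof -
  have "{v. v - y \<in> period_lat} = (\<lambda>v. y + v) ` period_lat"
  proof (intro equalityI subsetI)
    fix v assume "v \<in> {v. v - y \<in> period_lat}"
    then show "v \<in> (\<lambda>v. y + v) ` period_lat" by (intro image_eqI[of _ _ "v - y"]) simp_all
  qed auto
  then show ?thesis
    using haar_translate[OF borel_closed[OF closed_period_lat], of y] by (simp add: measure_def)
qed

text \<open>If the measure vanished, the indicator of \<open>period_lat\<close> would have zero
  Fourier transform, against the inversion formula at 0.\<close>

lemma measure_period_nonzero: "measure \<mu> period_lat \<noteq> 0"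
proof
  assume "measure \<mu> period_lat = 0"
  then have "emeasure \<mu> period_lat = 0"
    using haar_compact[OF compact_period_lat] by (simp add: emeasure_eq_ennreal_measure less_top)
  then have "period_lat \<in> null_sets \<mu>"
    using borel_closed[OF closed_period_lat] by (intro null_setsI) (simp_all add: haar_sets)
  then have AE: "AE v in \<mu>. v \<notin> period_lat" by (rule AE_not_in)
  have "fourier \<psi> \<mu> (ind 0) = (\<lambda>u. 0)"
  proof
    fix u
    show "fourier \<psi> \<mu> (ind 0) u = 0"
      unfolding fourier_def
      by (rule integral_eq_zero_AE, rule eventually_mono[OF AE]) (simp add: ind_def)
  qed
  then have "ind 0 0 = 0"
    using haar_inversion[OF S0_schwartz[OF ind_S0[OF lat_0]], of 0] by (simp add: fourier_def)
  then show False by (simp add: ind_def lat_0)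
qed

definition c_quotient :: "'k ^ 'n::_ \<Rightarrow> 'k ^ 'n::_" where
  "c_quotient z = (\<chi> j. z $ j / c j)"

text \<open>The symmetric bilinear form in the phase of the Fourier transform after the rescaling
  that puts it in the stabilizer of \<open>L\<close>.\<close>

definition pairing :: "'k ^ 'n::_ \<Rightarrow> 'k ^ 'n::_ \<Rightarrow> 'k" where
  "pairing y z = scalar_product y (c_quotient z)"

lemma pairing_commute: "pairing y z = pairing z y"
  by (simp add: pairing_def c_quotient_def scalar_product_def mult.commute)

lemma pairing_add: "pairing y (z + z') = pairing y z + pairing y z'"
  by (simp add: pairing_def c_quotient_def scalar_product_def add_divide_distrib distrib_left sum.distrib)

lemma pairing_uminus: "pairing (- y) z = - pairing y z"
  by (simp add: pairing_def scalar_product_linear)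

text \<open>The phase is constant on the coset of \<open>y\<close>: for \<open>v - y\<close> in
  \<open>period_lat\<close> the scalar product with \<open>c_quotient z\<close> lies in twice
  \<open>\<O>\<close>, and doubling it reaches the kernel of \<open>\<psi>\<close>. The integral is
  thus phase times measure.\<close>

lemma fourier_ind:
  assumes z: "z \<in> unit_lat"
  shows "fourier \<psi> \<mu> (ind y) (c_quotient z) = \<psi> (2 * pairing y z) * of_real (measure \<mu> period_lat)"
proof -
  let ?A = "{v. v - y \<in> period_lat}" and ?w = "c_quotient z"
  have "\<psi> (2 * scalar_product v ?w) * ind y v = \<psi> (2 * pairing y z) * of_real (indicator ?A v)" for v
  proof (cases "v - y \<in> period_lat")
    case True
    have "(v - y) $ j * ?w $ j / 2 \<in> \<O>" for j
    proof -
      have "(v - y) $ j / (2 * c j) * z $ j \<in> \<O>"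
        by (rule integer_ring_mult) (use True z in \<open>simp_all add: lat_def\<close>)
      then show ?thesis by (simp add: c_quotient_def mult.commute)
    qed
    then have "scalar_product (v - y) ?w / 2 \<in> \<O>" by (rule scalar_product_integral)
    then have 1: "\<psi> (2 * scalar_product (v - y) ?w) = 1"
      by (intro psi_trivial) (simp only: two_div_four)
    have "2 * scalar_product v ?w = 2 * pairing y z + 2 * scalar_product (v - y) ?w"
      by (simp add: pairing_def scalar_product_linear right_diff_distrib)
    then show ?thesis using True 1 by (simp add: psi_add ind_def)
  qed (simp add: ind_def)
  then have "fourier \<psi> \<mu> (ind y) ?w = \<psi> (2 * pairing y z) * of_real (integral\<^sup>L \<mu> (indicator ?A))"
    by (simp add: fourier_def)
  then show ?thesis by (simp add: haar_space measure_period_coset)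
qed

text \<open>The Weyl element exchanges the two halves of \<open>W\<close>, whose lattices have
  different scales; the diagonal matrix with entries \<open>1 / c j\<close> corrects this, giving
  the map from \<open>(x, y)\<close> to \<open>(y / c, - c x)\<close> on coordinates.\<close>

lemma fourier_lift:
  "\<exists>g\<in>K. \<exists>C. C \<noteq> 0 \<and> (\<forall>\<phi>\<in>schwartz. \<omega> g \<phi> = (\<lambda>z. C * fourier \<psi> \<mu> \<phi> (c_quotient z)))"
proof -
  define A B :: "'k ^ 'n::_ ^ 'n::_" where "A = (\<chi> r s. if r = s then 1 / c r else 0)"
    and "B = (\<chi> r s. if r = s then c r else 0)"
  have AB: "A ** B = mat 1" "B ** A = mat 1"
    by (simp_all add: A_def B_def matrix_matrix_mult_def mat_def vec_eq_iff if_distrib[of "\<lambda>x. x * _"]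
        cong: if_cong)
  then have inv: "invertible A" unfolding invertible_def by blast
  have tr: "transpose A = A" by (simp add: A_def transpose_def vec_eq_iff)
  have Av: "A *v y = c_quotient y" for y
    by (simp add: A_def c_quotient_def matrix_vector_mult_def vec_eq_iff if_distrib[of "\<lambda>x. x * _"] cong: if_cong)
  have Bv: "B *v y = (\<chi> j. c j * y $ j)" for y
    by (simp add: B_def matrix_vector_mult_def vec_eq_iff if_distrib[of "\<lambda>x. x * _"] cong: if_cong)
  obtain h \<beta> where h: "h \<in> carrier Mp" "root_of_unity \<beta>" "p h = block_matrix A 0 0 B"
    "\<And>\<phi>. \<phi> \<in> schwartz \<Longrightarrow> \<omega> h \<phi> = (\<lambda>y. \<beta> * of_real (sqrt (absval v (det A))) * \<phi> (c_quotient y))"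
    using formula_h[OF inv] unfolding tr Av matrix_inv_eq[OF AB] by blast
  obtain w \<gamma> where w: "w \<in> carrier Mp" "root_of_unity \<gamma>" "p w = block_matrix 0 (mat 1) (- mat 1) 0"
    "\<And>\<phi>. \<phi> \<in> schwartz \<Longrightarrow> \<omega> w \<phi> = (\<lambda>u. \<gamma> * fourier \<psi> \<mu> \<phi> u)"
    using formula_w by blast
  let ?g = "h \<otimes>\<^bsub>Mp\<^esub> w"
  have group: "group Mp" and hom: "p \<in> hom Mp Sp"
    using extension by (simp_all add: two_fold_central_extension_def)
  have gM: "?g \<in> carrier Mp" using group.is_monoid[OF group] h(1) w(1) by (rule monoid.m_closed)
  have "p ?g = p h ** p w" using hom_mult[OF hom h(1) w(1)] by (simp add: Sp_def)
  then have "p ?g *v u = p h *v (p w *v u)" for u by (simp add: matrix_vector_mul_assoc)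
  then have pg: "p ?g *v u = join_parts (c_quotient (Y_part u)) (\<chi> j. - (c j * X_part u $ j))" for u
    unfolding h(3) w(3) block_matrix_join parts_join_parts by (simp add: uminus_mat_vector Av Bv)
  have "?g \<in> K"
  proof (rule K_I[OF gM])
    show gL: "p ?g *v u \<in> L" if "u \<in> L" for u
      using that by (simp add: pg lattice_W_iff lat_def c_quotient_def)
    fix u assume "u \<in> L"
    then have "p ?g *v (- u) \<in> L" using additive_subgroupD(3)[OF L_subgroup] by (intro gL)
    \<comment> \<open>\<open>p ?g\<close> squares to \<open>- 1\<close>, so a preimage in
      \<open>L\<close> is obtained by applying it to \<open>- u\<close>.\<close>
    moreover have "u = p ?g *v (p ?g *v (- u))"
      by (rule parts_eqI) (simp_all add: pg c_quotient_def vec_eq_iff)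
    ultimately show "\<exists>u'\<in>L. u = p ?g *v u'" by blast
  qed
  moreover have nz: "z \<noteq> 0" if "root_of_unity z" for z
    using that by (auto simp: root_of_unity_def power_0_left)
  have "absval v (det A) > 0"
    using inv residue_card by (simp add: invertible_det_nz absval_def)
  then have "\<beta> * of_real (sqrt (absval v (det A))) * \<gamma> \<noteq> 0"
    using nz[OF h(2)] nz[OF w(2)] by simp
  moreover have "\<forall>\<phi>\<in>schwartz. \<omega> ?g \<phi> = (\<lambda>z. \<beta> * of_real (sqrt (absval v (det A))) * \<gamma> * fourier \<psi> \<mu> \<phi> (c_quotient z))"
    using omega_mult[OF h(1) w(1)] h(4)[OF omega_schwartz[OF w(1)]] w(4) by (simp add: mult.assoc)
  ultimately show ?thesis by blast
qed

lemma transfer: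
  "\<exists>g\<in>K. \<exists>C. C \<noteq> 0 \<and> (\<forall>\<epsilon>. \<forall>y\<in>unit_lat. \<forall>z\<in>unit_lat.
     \<omega> g (delta \<epsilon> y) z = C * (\<psi> (2 * pairing y z) + \<epsilon> * \<psi> (- (2 * pairing y z))))"
proof -
  obtain g C where g: "g \<in> K" "C \<noteq> 0" "\<And>\<phi>. \<phi> \<in> schwartz \<Longrightarrow> \<omega> g \<phi> = (\<lambda>z. C * fourier \<psi> \<mu> \<phi> (c_quotient z))"
    using fourier_lift by blast
  let ?m = "complex_of_real (measure \<mu> period_lat)"
  have "\<omega> g (delta \<epsilon> y) z = C * ?m * (\<psi> (2 * pairing y z) + \<epsilon> * \<psi> (- (2 * pairing y z)))"
    if y: "y \<in> unit_lat" and z: "z \<in> unit_lat" for \<epsilon> y z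
  proof -
    have gM: "g \<in> carrier Mp" by (rule K_carrier[OF g(1)])
    have y': "- y \<in> unit_lat" using y by simp
    have i: "ind y \<in> S0" "ind (- y) \<in> S0" using ind_S0[OF y] ind_S0[OF y'] .
    have "\<omega> g (delta \<epsilon> y) = (\<lambda>z. \<omega> g (ind y) z + \<omega> g (\<lambda>z. \<epsilon> * ind (- y) z) z)"
      unfolding delta_def
      by (rule omega_add[OF gM S0_schwartz[OF i(1)] S0_schwartz[OF fun_subspaceD(3)[OF S0_subspace i(2)]]])
    also have "\<dots> = (\<lambda>z. \<omega> g (ind y) z + \<epsilon> * \<omega> g (ind (- y)) z)"
      by (simp add: omega_scale[OF gM S0_schwartz[OF i(2)]])
    finally have "\<omega> g (delta \<epsilon> y) z = \<omega> g (ind y) z + \<epsilon> * \<omega> g (ind (- y)) z" by simp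
    also have "\<dots> = C * (\<psi> (2 * pairing y z) * ?m) + \<epsilon> * (C * (\<psi> (2 * pairing (- y) z) * ?m))"
      using g(3)[OF S0_schwartz[OF i(1)]] g(3)[OF S0_schwartz[OF i(2)]] fourier_ind[OF z] by simp
    finally show ?thesis by (simp add: pairing_uminus algebra_simps)
  qed
  then show ?thesis using g(1,2) measure_period_nonzero
    by (intro bexI[of _ g] exI[of _ "C * ?m"]) auto
qed

lemma pairing_nondegenerate:
  assumes "y \<notin> lat c"
  shows "\<exists>w\<in>unit_lat. \<psi> (4 * pairing y w) \<noteq> 1"
proof -
  obtain x where x: "x \<in> lat (\<lambda>j. 1 / c j)" "\<psi> (4 * scalar_product x y) \<noteq> 1"
    using dual_pairing_nondegenerate[OF assms] by blast
  have "(\<chi> j. c j * x $ j) \<in> unit_lat" using x(1) by (simp add: lat_def mult.commute)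
  moreover have "pairing y (\<chi> j. c j * x $ j) = scalar_product x y"
    by (simp add: pairing_def c_quotient_def scalar_product_def mult.commute)
  ultimately show ?thesis using x(2) by metis
qed

text \<open>The characters of \<open>y\<close> and \<open>z\<close> have proper kernels, and two proper subgroups do not cover \<open>unit_lat\<close>.\<close>
lemma common_partner:
  assumes "y \<notin> lat c" "z \<notin> lat c"
  shows "\<exists>w\<in>unit_lat. \<psi> (4 * pairing y w) \<noteq> 1 \<and> \<psi> (4 * pairing z w) \<noteq> 1"
proof -
  obtain a where a: "a \<in> unit_lat" "\<psi> (4 * pairing y a) \<noteq> 1" using pairing_nondegenerate[OF assms(1)] by blast
  obtain b where b: "b \<in> unit_lat" "\<psi> (4 * pairing z b) \<noteq> 1" using pairing_nondegenerate[OF assms(2)] by blast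
  show ?thesis
  \<comment> \<open>Either one of \<open>a\<close>, \<open>b\<close> already serves both vectors, or
    each is invisible to the other character and \<open>a + b\<close> serves both.\<close>
  proof (cases "\<psi> (4 * pairing z a) = 1 \<and> \<psi> (4 * pairing y b) = 1")
    case True
    then have "\<psi> (4 * pairing y (a + b)) \<noteq> 1 \<and> \<psi> (4 * pairing z (a + b)) \<noteq> 1"
      using a b by (simp add: pairing_add distrib_left psi_add)
    then show ?thesis using lat_add[OF a(1) b(1)] by blast
  next
    case False
    then show ?thesis using a b by blast
  qed
qed

end

section \<open>From one symmetrised indicator to the whole parity part\<close>

context parity_subrep
begin

text \<open>The Fourier element keeps \<open>V\<close> invariant, and its image of
  \<open>delta \<epsilon> y\<close> does not vanish at \<open>z\<close>, so \<open>delta_mem\<close>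
  applies there.\<close>

lemma delta_move:
  assumes y: "y \<in> unit_lat" "delta \<epsilon> y \<in> V" and z: "z \<in> unit_lat"
    and nz: "\<psi> (2 * pairing y z) + \<epsilon> * \<psi> (- (2 * pairing y z)) \<noteq> 0"
  shows "delta \<epsilon> z \<in> V"
proof -
  obtain g C where g: "g \<in> K" "C \<noteq> 0" "\<And>y z. y \<in> unit_lat \<Longrightarrow> z \<in> unit_lat \<Longrightarrow>
      \<omega> g (delta \<epsilon> y) z = C * (\<psi> (2 * pairing y z) + \<epsilon> * \<psi> (- (2 * pairing y z)))"
    using transfer by blast
  show ?thesis
    by (rule delta_mem[OF V_omega[OF g(1) y(2)] z]) (use g(2) g(3)[OF y(1) z] nz in simp)
qed

lemma parity_part_le:
  assumes all: "\<And>y. y \<in> unit_lat \<Longrightarrow> delta \<epsilon> y \<in> V"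
  shows "parity_part \<epsilon> \<subseteq> V"
proof
  fix \<phi> assume \<phi>: "\<phi> \<in> parity_part \<epsilon>"
  have S: "\<phi> \<in> S0" by (rule parity_partD(1)[OF \<phi>])
  obtain R where R: "transversal unit_lat period_lat R"
    using lat_transversal[of "\<lambda>_. 1" "\<lambda>j. 2 * c j"] two_nonzero by auto
  have RL: "r \<in> unit_lat" if "r \<in> R" for r
    using R that by (auto simp: transversal_def)
  have finR: "finite R" using R by (simp add: transversal_def)
  have expand: "(\<Sum>r\<in>R. \<phi> r * ind r z) = \<phi> z" for z
  proof (cases "z \<in> unit_lat")
    case True
    then obtain r0 where r0: "r0 \<in> R" "z - r0 \<in> period_lat" "\<And>r. r \<in> R \<Longrightarrow> z - r \<in> period_lat \<Longrightarrow> r = r0"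
      using R unfolding transversal_def by metis
    have "(\<Sum>r\<in>R. \<phi> r * ind r z) = (\<Sum>r\<in>R. if r = r0 then \<phi> z else 0)"
    proof (rule sum.cong[OF refl])
      fix r assume r: "r \<in> R"
      show "\<phi> r * ind r z = (if r = r0 then \<phi> z else 0)"
      proof (cases "r = r0")
        case True
        then show ?thesis using r0(2) S0_periodic[OF S r0(2)] by (simp add: ind_def)
      next
        case False
        then have "z - r \<notin> period_lat" using r0(3)[OF r] by blast
        then show ?thesis using False by (simp add: ind_def)
      qed
    qed
    then show ?thesis using r0(1) finR by simp
  next
    case False
    have "ind r z = 0" if "r \<in> R" for r
      using S0_support[OF ind_S0[OF RL[OF that]] False] .
    then show ?thesis using S0_support[OF S False] by simp
  qed
  \<comment> \<open>Symmetrising the expansion of \<open>\<phi>\<close> in coset indicators produces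
    \<open>\<phi> z\<close> and \<open>\<epsilon> * \<phi> (- z)\<close>, which are equal; the
    factor one half averages them.\<close>
  have "(\<lambda>z. \<Sum>r\<in>R. (\<phi> r / 2) * delta \<epsilon> r z) \<in> V"
    by (intro fun_subspace_sum[OF V_subspace] fun_subspaceD(3)[OF V_subspace] all RL)
  moreover have "(\<Sum>r\<in>R. (\<phi> r / 2) * delta \<epsilon> r z) = \<phi> z" for z
  proof -
    have "(\<Sum>r\<in>R. (\<phi> r / 2) * delta \<epsilon> r z) = (\<Sum>r\<in>R. \<phi> r * ind r z) / 2 + \<epsilon> * (\<Sum>r\<in>R. \<phi> r * ind r (- z)) / 2"
      unfolding delta_def ind_reflect sum_distrib_left sum_divide_distrib sum.distrib[symmetric]
      by (rule sum.cong) (simp_all add: field_simps)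
    also have "\<dots> = \<phi> z / 2 + (\<epsilon> * \<epsilon>) * \<phi> z / 2"
      unfolding expand parity_partD(2)[OF \<phi>] by (simp only: mult.assoc)
    also have "\<dots> = \<phi> z" by (simp add: sign_square)
    finally show ?thesis .
  qed
  ultimately show "\<phi> \<in> V" by simp
qed

end

section \<open>Irreducibility and the decomposition by parity\<close>

context weil_setup
begin

text \<open>For \<open>y\<close> in \<open>lat c\<close> the vectors \<open>y\<close> and
  \<open>- y\<close> differ by a period, so the value equals its own negative.\<close>

lemma odd_vanishes:
  assumes "\<phi> \<in> parity_part (- 1)" "y \<in> lat c"
  shows "\<phi> y = 0"
proof -
  have "y - - y = 2 *s y" by (simp add: vec_eq_iff)
  then have "y - - y \<in> period_lat" using assms(2) by (simp only: double_mem_period)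
  from S0_periodic[OF parity_partD(1)[OF assms(1)] this] show ?thesis
    using parity_partD(2)[OF assms(1), of y] by simp
qed

lemma parity_part_irreducible:
  assumes \<epsilon>: "\<epsilon> = 1 \<or> \<epsilon> = - 1" and nonzero: "parity_part \<epsilon> \<noteq> {\<lambda>y. 0}"
  shows "acts_irreducibly K \<omega> (parity_part \<epsilon>)"
  unfolding acts_irreducibly_def
proof (intro conjI allI impI parity_part_subspace parity_part_stable nonzero)
  fix V assume V: "fun_subspace V \<and> V \<subseteq> parity_part \<epsilon> \<and> stable_under K \<omega> V"
  have sq: "\<epsilon> * \<epsilon> = 1" using \<epsilon> by (elim disjE) simp_all
  have V': "fun_subspace V" "V \<subseteq> parity_part \<epsilon>" "stable_under K \<omega> V"
    using V by (simp_all only:)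
  interpret parity_subrep v \<pi> \<psi> \<mu> Mp p \<omega> i \<epsilon> V
    by (rule parity_subrep.intro[OF weil_setup_axioms parity_subrep_axioms.intro[OF sq V']])
  show "V = {\<lambda>y. 0} \<or> V = parity_part \<epsilon>"
  proof (cases "\<exists>\<phi>\<in>V. \<phi> \<noteq> (\<lambda>y. 0)")
    case False
    then have "V \<subseteq> {\<lambda>y. 0}" by blast
    moreover have "{\<lambda>y. 0} \<subseteq> V" using fun_subspaceD(1)[OF V_subspace] by simp
    ultimately show ?thesis by (intro disjI1 equalityI)
  next
    case True
    then obtain \<phi> where \<phi>V: "\<phi> \<in> V" "\<phi> \<noteq> (\<lambda>y. 0)" by (elim bexE)
    from \<phi>V(2) obtain y where "\<phi> y \<noteq> 0" unfolding fun_eq_iff by blast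
    note \<phi> = \<phi>V(1) this
    have y: "y \<in> unit_lat" using S0_support[OF V_S0[OF \<phi>(1)], of y] \<phi>(2) by blast
    have dy: "delta \<epsilon> y \<in> V" by (rule delta_mem[OF \<phi>(1) y \<phi>(2)])
    have "delta \<epsilon> z \<in> V" if z: "z \<in> unit_lat" for z
    proof (cases "\<epsilon> = 1")
      case True
      have 0: "pairing y 0 = 0" "pairing 0 z = 0" for y z
        by (simp_all add: pairing_def c_quotient_def scalar_product_def)
      \<comment> \<open>The pairing with 0 vanishes, so the even kernel is 2 there: 0 is reached
        from \<open>y\<close>, and every \<open>z\<close> from 0.\<close>
      have "delta \<epsilon> 0 \<in> V" by (rule delta_move[OF y dy lat_0]) (simp add: 0 True)
      then show ?thesis by (rule delta_move[OF lat_0 _ z]) (simp add: 0 True)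
    next
      case False
      then have \<epsilon>: "\<epsilon> = - 1" using \<epsilon> by simp
      \<comment> \<open>Multiplying the odd kernel by \<open>\<psi> (2 * s)\<close> gives
        \<open>\<psi> (4 * s) - 1\<close>.\<close>
      have ne: "\<psi> (2 * s) + \<epsilon> * \<psi> (- (2 * s)) \<noteq> 0" if "\<psi> (4 * s) \<noteq> 1" for s
      proof
        assume "\<psi> (2 * s) + \<epsilon> * \<psi> (- (2 * s)) = 0"
        then have "\<psi> (2 * s) * \<psi> (2 * s) = 1" by (simp add: \<epsilon> psi_uminus field_simps)
        moreover have "2 * s + 2 * s = 4 * s" by simp
        ultimately show False using that psi_add[of "2 * s" "2 * s"] by simp
      qed
      show ?thesis
      proof (cases "z \<in> lat c")
        case True
        \<comment> \<open>Here \<open>z\<close> and \<open>- z\<close> lie in the same class and the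
          two indicators cancel.\<close>
        have "delta \<epsilon> z = (\<lambda>x. 0)"
        proof
          fix x
          have eq: "x - - z = (x - z) + 2 *s z" by (simp add: vec_eq_iff)
          have per: "2 *s z \<in> period_lat" using True by (simp only: double_mem_period)
          have "x - - z \<in> period_lat \<longleftrightarrow> x - z \<in> period_lat"
            using lat_add[OF _ per, of "x - z"] lat_diff[OF _ per, of "x - z + 2 *s z"]
            unfolding eq by auto
          then show "delta \<epsilon> z x = 0" by (simp add: delta_def ind_def \<epsilon>)
        qed
        then show ?thesis using fun_subspaceD(1)[OF V_subspace] by simp
      next
        case False
        have "y \<notin> lat c" using odd_vanishes[of \<phi> y] \<phi> V_subset \<epsilon> by blast
        then obtain w where w: "w \<in> unit_lat" "\<psi> (4 * pairing y w) \<noteq> 1" "\<psi> (4 * pairing z w) \<noteq> 1"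
          using common_partner False by blast
        have "delta \<epsilon> w \<in> V" by (rule delta_move[OF y dy w(1) ne[OF w(2)]])
        then show ?thesis
          using w(3) by (intro delta_move[OF w(1) _ z ne]) (simp_all add: pairing_commute)
      qed
    qed
    then have "parity_part \<epsilon> \<subseteq> V" by (rule parity_part_le)
    then show ?thesis using V_subset by blast
  qed
qed

lemma even_part_nonzero: "even_part S0 \<noteq> {\<lambda>y. 0}"
proof -
  have "delta 1 0 \<in> parity_part 1" by (rule delta_parity[OF lat_0]) simp
  moreover have "delta 1 0 0 \<noteq> 0" by (simp add: delta_def ind_def lat_0)
  ultimately show ?thesis unfolding even_part_eq by (auto simp: fun_eq_iff)
qed

lemma odd_part_nonzero:
  assumes "i \<noteq> 0"
  shows "odd_part S0 \<noteq> {\<lambda>y. 0}"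
proof -
  obtain j :: "'n::_" where j: "card {..<j} < i"
  \<comment> \<open>The least index has no predecessors, so it is among the first \<open>i\<close>
    as soon as \<open>i\<close> is nonzero. For it \<open>c j = \<pi>\<close>, and the corresponding
    unit vector is not congruent to its negative.\<close>
  proof
    have "{..<Min (UNIV :: 'n::_ set)} = {}" by auto
    then show "card {..<Min (UNIV :: 'n::_ set)} < i" using assms by simp
  qed
  let ?y = "axis j 1 :: 'k ^ 'n::_"
  have "c j = \<pi>" using j by (simp add: c_def)
  then have "?y \<notin> lat c"
    by (auto simp: lat_def axis_def integer_ring_def val_divide val_uniformizer intro!: exI[of _ j])
  moreover have "?y - - ?y = 2 *s ?y" by (simp add: vec_eq_iff)
  ultimately have "?y - - ?y \<notin> period_lat" by (simp only: double_mem_period simp_thms)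
  then have "delta (- 1) ?y ?y \<noteq> 0" by (simp add: delta_def ind_def lat_0)
  moreover have "delta (- 1) ?y \<in> parity_part (- 1)"
    by (rule delta_parity) (simp_all add: lat_def axis_def)
  ultimately show ?thesis unfolding odd_part_eq by (auto simp: fun_eq_iff)
qed

lemma parity_decomposition:
  "S0 = {(\<lambda>y. \<phi> y + \<eta> y) | \<phi> \<eta>. \<phi> \<in> even_part S0 \<and> \<eta> \<in> odd_part S0}"
proof (intro equalityI subsetI)
  fix \<phi> assume \<phi>: "\<phi> \<in> S0"
  let ?e = "\<lambda>y. (1 / 2) * (\<phi> y + \<phi> (- y))" and ?o = "\<lambda>y. (1 / 2) * (\<phi> y + (- 1) * \<phi> (- y))"
  have "?e \<in> even_part S0"
    using \<phi> by (simp add: even_part_def add.commute fun_subspaceD[OF S0_subspace] S0_reflect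
        del: times_divide_eq_left)
  moreover have "?o \<in> odd_part S0"
  proof -
    have "?o \<in> S0" by (intro fun_subspaceD[OF S0_subspace] \<phi> S0_reflect)
    moreover have "?o (- y) = - ?o y" for y by (simp add: field_simps)
    ultimately show ?thesis by (simp only: odd_part_def mem_Collect_eq simp_thms)
  qed
  moreover have "\<phi> = (\<lambda>y. ?e y + ?o y)" by (simp add: fun_eq_iff field_simps)
  ultimately show "\<phi> \<in> {(\<lambda>y. \<phi> y + \<eta> y) | \<phi> \<eta>. \<phi> \<in> even_part S0 \<and> \<eta> \<in> odd_part S0}"
    by (intro CollectI exI[of _ ?e] exI[of _ ?o] conjI)
next
  fix \<phi> assume "\<phi> \<in> {(\<lambda>y. \<phi> y + \<eta> y) | \<phi> \<eta>. \<phi> \<in> even_part S0 \<and> \<eta> \<in> odd_part S0}"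
  then show "\<phi> \<in> S0" by (auto simp: even_part_def odd_part_def fun_subspaceD[OF S0_subspace])
qed

lemma parity_intersection: "even_part S0 \<inter> odd_part S0 = {\<lambda>y. 0}"
  using fun_subspaceD(1)[OF S0_subspace] by (force simp: even_part_def odd_part_def fun_eq_iff)

text \<open>For \<open>i = 0\<close> the periods are all doubles of integral vectors, so every
  integral \<open>y\<close> is congruent to \<open>- y\<close> and every function in
  \<open>S0\<close> is even.\<close>

lemma odd_part_trivial:
  assumes "i = 0"
  shows "odd_part S0 = {\<lambda>y. 0}" "even_part S0 = S0"
proof -
  have c: "c = (\<lambda>_. 1)" unfolding c_def fun_eq_iff by (simp add: assms)
  have per: "\<phi> (- y) = \<phi> y" if "\<phi> \<in> S0" for \<phi> y
  proof (cases "y \<in> unit_lat")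
    case True
    have "y - - y = 2 *s y" by (simp add: vec_eq_iff)
    then have "y - - y \<in> period_lat" using True by (simp only: double_mem_period) (simp only: c)
    then show ?thesis using S0_periodic[OF that] by metis
  qed (simp add: S0_support[OF that])
  show "even_part S0 = S0" using per by (auto simp: even_part_def)
  then show "odd_part S0 = {\<lambda>y. 0}" using parity_intersection by (auto simp: odd_part_def)
qed

end

theorem theorem1:
  fixes v :: "'k::{field,complete_space} \<Rightarrow> int"
    and \<pi> :: 'k
    and \<psi> :: "'k \<Rightarrow> complex"
    and \<mu> :: "('k ^ 'n::{finite,linorder}) measure"
    and Mp :: "('g, 'b) monoid_scheme"
    and p :: "'g \<Rightarrow> 'k ^ ('n::{finite,linorder} + 'n) ^ ('n + 'n)"
    and \<omega> :: "'g \<Rightarrow> ('k ^ 'n::_ \<Rightarrow> complex) \<Rightarrow> 'k ^ 'n::_ \<Rightarrow> complex"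
    and i :: nat
  defines "S \<equiv> (S_space v \<pi> i :: int \<Rightarrow> ('k ^ 'n::_ \<Rightarrow> complex) set)"
    and "S' \<equiv> (S'_space v \<pi> i :: int \<Rightarrow> ('k ^ 'n::_ \<Rightarrow> complex) set)"
    and "K \<equiv> stabilizer_K_cover v \<pi> Mp p i"
  assumes "nonarch_local_field v"
    and "(2 :: 'k) \<noteq> 0"
    and "\<pi> \<noteq> 0" and "v \<pi> = 1"
    and "smooth_additive_character \<psi>" and "\<exists>x. \<psi> x \<noteq> 1" and "has_conductor_2e v \<psi>"
    and "self_dual_haar \<psi> \<mu>"
    and "weil_representation v \<psi> \<mu> Mp p \<omega>"
    and "i \<le> CARD('n)"
  shows "(\<forall>m\<ge>0. S m \<subseteq> S' (m + 1) \<and> S' (m + 1) \<subseteq> S (m + 1))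
    \<and> (\<forall>m\<ge>0. stable_under K \<omega> (S m))
    \<and> (\<forall>m\<ge>1. stable_under K \<omega> (S' m))
    \<and> S 0 = {(\<lambda>y. \<phi> y + \<eta> y) | \<phi> \<eta>. \<phi> \<in> even_part (S 0) \<and> \<eta> \<in> odd_part (S 0)}
    \<and> even_part (S 0) \<inter> odd_part (S 0) = {\<lambda>y. 0}
    \<and> acts_irreducibly K \<omega> (even_part (S 0))
    \<and> (i \<noteq> 0 \<longrightarrow> acts_irreducibly K \<omega> (odd_part (S 0)))
    \<and> (i = 0 \<longrightarrow> odd_part (S 0) = {\<lambda>y. 0} \<and> even_part (S 0) = S 0)"
proof -
  interpret nonarch_local_field v by fact
  interpret weil_representation v \<psi> \<mu> Mp p \<omega> by fact
  interpret weil_setup v \<pi> \<psi> \<mu> Mp p \<omega> i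
    using assms by unfold_locales auto
  show ?thesis
    unfolding S_def S'_def K_def
  proof (intro conjI allI impI)
    fix m :: int
    show "S_space v \<pi> i m \<subseteq> (S'_space v \<pi> i (m + 1) :: ('k ^ 'n::_ \<Rightarrow> complex) set)" by (rule S_subset_S')
    show "S'_space v \<pi> i (m + 1) \<subseteq> (S_space v \<pi> i (m + 1) :: ('k ^ 'n::_ \<Rightarrow> complex) set)" by (rule S'_subset_S)
  next
    show "acts_irreducibly (stabilizer_K_cover v \<pi> Mp p i) \<omega> (even_part S0)"
      using parity_part_irreducible[of 1] even_part_nonzero by (simp add: even_part_eq)
    show "acts_irreducibly (stabilizer_K_cover v \<pi> Mp p i) \<omega> (odd_part S0)" if "i \<noteq> 0"
      using parity_part_irreducible[of "- 1"] odd_part_nonzero[OF that] by (simp add: odd_part_eq)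
    show "odd_part S0 = {\<lambda>y. 0}" "even_part S0 = S0" if "i = 0"
      by (fact odd_part_trivial[OF that])+
  qed (simp_all only: stable_S stable_S' parity_intersection parity_decomposition[symmetric])
qed

end
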